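(* Let $n$ be a positive integer, let $p_1 \neq p_2$ and $q_1 \neq q_2$ be primes (the sets $\{p_1,p_2\}$ and $\{q_1,q_2\}$ need not be disjoint), and let $a = p_1^n p_2^n$ and $b = q_1^n q_2^n$. Then \[\mathcal{A}(a,b) = \sum_{i=0}^{2n} (-1)^{n+i}\binom{2n}{i}^4 = (-1)^n\left[\binom{2n}{0}^4 - \binom{2n}{1}^4 + \binom{2n}{2}^4 - \cdots + \binom{2n}{2n}^4\right].\]
   Context: For positive integers $a,b$, $\mathcal{A}(a,b)$ denotes the number of essentially distinct $\alpha$-graceful labelings of the complete bipartite graph $K_{a,b}$; equivalently, $\mathcal{A}(a,b)$ is the number of ordered pairs $(S', S'')$ of sets of nonnegative integers with $|S'| = a$, $|S''| = b$, $S', S'' \subseteq \{0,1,\ldots,ab\}$, and $S'' - S' = \{y - x \mid x \in S',\ y \in S''\} = \{1,2,\ldots,ab\}$. (An $\alpha$-graceful labeling of a bipartite graph with $e$ edges assigns to each vertex a label in $\{0,\dots,e\}$ so that every left label is strictly smaller than every right label and the edge labels $|$difference of endpoint labels$|$ are exactly $1,\dots,e$, each once; two labelings are essentially the same if they differ by a graph automorphism.) *)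

theory Defs
  imports Main "HOL-Library.FuncSet" "HOL-Computational_Algebra.Primes"
begin

text \<open>
  A bipartite graph with left side \<open>L\<close> and right side \<open>R\<close> is given by its set of edges
  \<open>E \<subseteq> L \<times> R\<close>, each (undirected) edge being written with its left endpoint first.
\<close>

definition adjacent :: "('v \<times> 'v) set \<Rightarrow> 'v \<Rightarrow> 'v \<Rightarrow> bool" where
  "adjacent E u v \<longleftrightarrow> (u, v) \<in> E \<or> (v, u) \<in> E"

text \<open>Automorphisms of the underlying graph: they are allowed to exchange the two sides.\<close>

definition graph_automorphism :: "'v set \<Rightarrow> ('v \<times> 'v) set \<Rightarrow> ('v \<Rightarrow> 'v) \<Rightarrow> bool" where
  "graph_automorphism V E \<sigma> \<longleftrightarrow>
     bij_betw \<sigma> V V \<and> (\<forall>u\<in>V. \<forall>v\<in>V. adjacent E (\<sigma> u) (\<sigma> v) \<longleftrightarrow> adjacent E u v)"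

definition edge_label :: "('v \<Rightarrow> nat) \<Rightarrow> 'v \<times> 'v \<Rightarrow> int" where
  "edge_label f e = \<bar>int (f (fst e)) - int (f (snd e))\<bar>"

text \<open>
  Labelings are extensional functions (\<open>undefined\<close> outside the vertex set), so that two of them
  are equal iff they agree on all vertices.
\<close>

definition alpha_graceful_labelings ::
    "'v set \<Rightarrow> 'v set \<Rightarrow> ('v \<times> 'v) set \<Rightarrow> ('v \<Rightarrow> nat) set" where
  "alpha_graceful_labelings L R E =
     {f \<in> (L \<union> R) \<rightarrow>\<^sub>E {0..card E}.
        (\<forall>x\<in>L. \<forall>y\<in>R. f x < f y) \<and>
        bij_betw (edge_label f) E {1..int (card E)}}"

definition essentially_same ::
    "'v set \<Rightarrow> 'v set \<Rightarrow> ('v \<times> 'v) set \<Rightarrow> (('v \<Rightarrow> nat) \<times> ('v \<Rightarrow> nat)) set" where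
  "essentially_same L R E =
     {(f, g). f \<in> alpha_graceful_labelings L R E \<and> g \<in> alpha_graceful_labelings L R E \<and>
        (\<exists>\<sigma>. graph_automorphism (L \<union> R) E \<sigma> \<and> (\<forall>v\<in>L \<union> R. g v = f (\<sigma> v)))}"

definition K_left :: "nat \<Rightarrow> (nat + nat) set" where
  "K_left a = Inl ` {..<a}"

definition K_right :: "nat \<Rightarrow> (nat + nat) set" where
  "K_right b = Inr ` {..<b}"

text \<open>\<open>\<A>(a,b)\<close>: the number of classes of essentially equal labelings of \<open>K\<^bsub>a,b\<^esub>\<close>.\<close>

definition num_alpha :: "nat \<Rightarrow> nat \<Rightarrow> nat" where
  "num_alpha a b =
     (let L = K_left a; R = K_right b; E = L \<times> R
      in card (alpha_graceful_labelings L R E // essentially_same L R E))"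

text \<open>
  The description of \<open>\<A>(a,b)\<close> by pairs of label sets; differences are taken in the integers.
\<close>

definition label_set_pairs :: "nat \<Rightarrow> nat \<Rightarrow> (nat set \<times> nat set) set" where
  "label_set_pairs a b =
     {(S, T). S \<subseteq> {0..a * b} \<and> T \<subseteq> {0..a * b} \<and> card S = a \<and> card T = b \<and>
        {int y - int x | x y. x \<in> S \<and> y \<in> T} = {1..int (a * b)}}"

lemma equiv_essentially_same:
  "equiv (alpha_graceful_labelings L R E) (essentially_same L R E)"
proof (rule equivI)
  show "essentially_same L R E \<subseteq> alpha_graceful_labelings L R E \<times> alpha_graceful_labelings L R E"
    by (auto simp: essentially_same_def)
  show "refl_on (alpha_graceful_labelings L R E) (essentially_same L R E)"
    by (auto simp: refl_on_def essentially_same_def graph_automorphism_def intro!: exI[of _ id])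
  show "sym (essentially_same L R E)"
  proof (rule symI)
    fix f g assume "(f, g) \<in> essentially_same L R E"
    then obtain s where fg: "f \<in> alpha_graceful_labelings L R E" "g \<in> alpha_graceful_labelings L R E"
      and s: "graph_automorphism (L \<union> R) E s" "\<forall>v\<in>L \<union> R. g v = f (s v)"
      by (auto simp: essentially_same_def)
    let ?V = "L \<union> R" and ?t = "inv_into (L \<union> R) s"
    have b: "bij_betw s ?V ?V" using s(1) by (simp add: graph_automorphism_def)
    have t: "bij_betw ?t ?V ?V" by (rule bij_betw_inv_into[OF b])
    have tV: "?t v \<in> ?V" if "v \<in> ?V" for v using t that by (rule bij_betwE[THEN bspec])
    have st: "s (?t v) = v" if "v \<in> ?V" for v by (rule bij_betw_inv_into_right[OF b that])
    have "graph_automorphism ?V E ?t"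
      unfolding graph_automorphism_def
    proof (intro conjI ballI t)
      fix u v assume "u \<in> ?V" "v \<in> ?V"
      then show "adjacent E (?t u) (?t v) = adjacent E u v"
        using s(1) tV st unfolding graph_automorphism_def by metis
    qed
    moreover have "\<forall>v\<in>?V. f v = g (?t v)" using s(2) tV st by simp
    ultimately show "(g, f) \<in> essentially_same L R E"
      using fg unfolding essentially_same_def by blast
  qed
  show "trans (essentially_same L R E)"
  proof (rule transI)
    fix f g h assume "(f, g) \<in> essentially_same L R E" "(g, h) \<in> essentially_same L R E"
    then obtain s t where fh: "f \<in> alpha_graceful_labelings L R E" "h \<in> alpha_graceful_labelings L R E"
      and s: "graph_automorphism (L \<union> R) E s" "\<forall>v\<in>L \<union> R. g v = f (s v)"
      and t: "graph_automorphism (L \<union> R) E t" "\<forall>v\<in>L \<union> R. h v = g (t v)"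
      by (auto simp: essentially_same_def)
    have tV: "t v \<in> L \<union> R" if "v \<in> L \<union> R" for v
      using t(1) that unfolding graph_automorphism_def by (meson bij_betwE)
    have "graph_automorphism (L \<union> R) E (s \<circ> t)"
      using s(1) t(1) tV unfolding graph_automorphism_def
      by (metis bij_betw_trans comp_apply)
    moreover have "\<forall>v\<in>L \<union> R. h v = f ((s \<circ> t) v)" using s(2) t(2) tV by simp
    ultimately show "(f, h) \<in> essentially_same L R E"
      using fh unfolding essentially_same_def by blast
  qed
qed

lemma num_alpha_eq_card_label_set_pairs:
  assumes a: "a > 0" and b: "b > 0"
  shows "num_alpha a b = card (label_set_pairs a b)"
proof -
  define L R where "L = K_left a" and "R = K_right b"
  define V where "V = L \<union> R"
  let ?E = "L \<times> R"
  let ?A = "alpha_graceful_labelings L R ?E"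
  let ?r = "essentially_same L R ?E"
  define \<phi> where "\<phi> = (\<lambda>f :: nat + nat \<Rightarrow> nat. (f ` L, f ` R))"
  have fin: "finite L" "finite R" by (auto simp: L_def R_def K_left_def K_right_def)
  have cL: "card L = a" and cR: "card R = b"
    by (auto simp: L_def R_def K_left_def K_right_def card_image)
  have disj: "L \<inter> R = {}" by (auto simp: L_def R_def K_left_def K_right_def)
  have cE: "card ?E = a * b" by (simp add: card_cartesian_product cL cR)
  obtain l0 where l0: "l0 \<in> L" using cL a by fastforce
  obtain r0 where r0: "r0 \<in> R" using cR b by fastforce
  have less: "f x < f y" if "f \<in> ?A" "x \<in> L" "y \<in> R" for f x y
    using that by (auto simp: alpha_graceful_labelings_def)
  have bij: "bij_betw (edge_label f) ?E {1..int (a * b)}" if "f \<in> ?A" for f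
    using that cE by (simp add: alpha_graceful_labelings_def)
  have injL: "inj_on f L" if "f \<in> ?A" for f
  proof (rule inj_onI)
    fix x x' assume "x \<in> L" "x' \<in> L" "f x = f x'"
    then have "(x, r0) = (x', r0)"
      using r0 by (intro inj_onD[OF bij_betw_imp_inj_on[OF bij[OF that]]]) (auto simp: edge_label_def)
    then show "x = x'" by simp
  qed
  have injR: "inj_on f R" if "f \<in> ?A" for f
  proof (rule inj_onI)
    fix x x' assume "x \<in> R" "x' \<in> R" "f x = f x'"
    then have "(l0, x) = (l0, x')"
      using l0 by (intro inj_onD[OF bij_betw_imp_inj_on[OF bij[OF that]]]) (auto simp: edge_label_def)
    then show "x = x'" by simp
  qed
  have adj: "adjacent ?E u v \<longleftrightarrow> (u \<in> L \<and> v \<in> R) \<or> (u \<in> R \<and> v \<in> L)" for u v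
    by (auto simp: adjacent_def)
  have inv: "\<phi> f = \<phi> g" if fg: "(f, g) \<in> ?r" for f g
  proof -
    from fg obtain s where f: "f \<in> ?A" and g: "g \<in> ?A"
      and s: "graph_automorphism V ?E s" "\<forall>v\<in>V. g v = f (s v)"
      by (auto simp: essentially_same_def V_def)
    have bs: "bij_betw s V V"
      and as: "\<And>u v. u \<in> V \<Longrightarrow> v \<in> V \<Longrightarrow> adjacent ?E (s u) (s v) = adjacent ?E u v"
      using s(1) by (auto simp: graph_automorphism_def)
    have key: "s x \<in> L \<and> s y \<in> R" if "x \<in> L" "y \<in> R" for x y
    proof (rule ccontr)
      assume "\<not> (s x \<in> L \<and> s y \<in> R)"
      moreover have "adjacent ?E (s x) (s y)" using as[of x y] that by (auto simp: V_def adj)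
      ultimately have "s x \<in> R" "s y \<in> L" by (auto simp: adj)
      then have "f (s y) < f (s x)" using less[OF f] by blast
      moreover have "f (s x) < f (s y)" using less[OF g that] s(2) that by (simp add: V_def)
      ultimately show False by simp
    qed
    have injs: "inj_on s V" using bs by (simp add: bij_betw_def)
    have "s ` L = L"
      by (rule endo_inj_surj[OF fin(1)]) (use key r0 injs in \<open>auto simp: V_def inj_on_Un\<close>)
    moreover have "s ` R = R"
      by (rule endo_inj_surj[OF fin(2)]) (use key l0 injs in \<open>auto simp: V_def inj_on_Un\<close>)
    moreover have "g ` L = f ` (s ` L)" "g ` R = f ` (s ` R)"
      using s(2) by (auto simp: V_def image_iff)
    ultimately show ?thesis by (simp add: \<phi>_def)
  qed
  have conv: "(f, g) \<in> ?r" if f: "f \<in> ?A" and g: "g \<in> ?A" and eq: "\<phi> f = \<phi> g" for f g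
  proof -
    define s where "s v = (if v \<in> L then inv_into L f (g v) else inv_into R f (g v))" for v
    have bf: "bij_betw f L (f ` L)" "bij_betw f R (f ` R)"
      using injL[OF f] injR[OF f] by (auto simp: bij_betw_def)
    have bg: "bij_betw g L (f ` L)" "bij_betw g R (f ` R)"
      using injL[OF g] injR[OF g] eq by (auto simp: bij_betw_def \<phi>_def)
    have "bij_betw (inv_into L f \<circ> g) L L"
      by (rule bij_betw_trans[OF bg(1) bij_betw_inv_into[OF bf(1)]])
    then have sL: "bij_betw s L L"
      by (rule bij_betw_cong[THEN iffD1, rotated]) (simp add: s_def)
    have "bij_betw (inv_into R f \<circ> g) R R"
      by (rule bij_betw_trans[OF bg(2) bij_betw_inv_into[OF bf(2)]])
    then have sR: "bij_betw s R R"
      by (rule bij_betw_cong[THEN iffD1, rotated]) (use disj in \<open>auto simp: s_def\<close>)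
    have sLR: "x \<in> L \<Longrightarrow> s x \<in> L" "x \<in> R \<Longrightarrow> s x \<in> R" for x
      using bij_betwE[OF sL] bij_betwE[OF sR] by auto
    have "graph_automorphism (L \<union> R) ?E s"
      unfolding graph_automorphism_def
    proof (intro conjI ballI)
      show "bij_betw s (L \<union> R) (L \<union> R)" by (rule bij_betw_combine[OF sL sR disj])
      fix u v assume "u \<in> L \<union> R" "v \<in> L \<union> R"
      then show "adjacent ?E (s u) (s v) = adjacent ?E u v"
        using sLR disj unfolding adj by blast
    qed
    moreover have "\<forall>v\<in>L \<union> R. g v = f (s v)"
    proof
      fix v assume v: "v \<in> L \<union> R"
      show "g v = f (s v)"
      proof (cases "v \<in> L")
        case True
        then have "g v \<in> f ` L" using bij_betwE[OF bg(1)] by blast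
        then show ?thesis using True by (simp add: s_def f_inv_into_f)
      next
        case False
        then have "g v \<in> f ` R" using bij_betwE[OF bg(2)] v by blast
        then show ?thesis using False by (simp add: s_def f_inv_into_f)
      qed
    qed
    ultimately show ?thesis using f g unfolding essentially_same_def by blast
  qed
  have img1: "\<phi> f \<in> label_set_pairs a b" if f: "f \<in> ?A" for f
  proof -
    have "f ` L \<subseteq> {0..a * b}" "f ` R \<subseteq> {0..a * b}"
      using f cE by (auto simp: alpha_graceful_labelings_def PiE_iff)
    moreover have "card (f ` L) = a" "card (f ` R) = b"
      using injL[OF f] injR[OF f] cL cR by (simp_all add: card_image)
    moreover have "{int y - int x | x y. x \<in> f ` L \<and> y \<in> f ` R} = edge_label f ` ?E"
      (is "?D = _")
    proof (intro equalityI subsetI)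
      fix d assume "d \<in> ?D"
      then obtain x y where "x \<in> L" "y \<in> R" "d = int (f y) - int (f x)" by auto
      then show "d \<in> edge_label f ` ?E"
        using less[OF f, of x y] by (intro image_eqI[of _ _ "(x, y)"]) (auto simp: edge_label_def)
    next
      fix d assume "d \<in> edge_label f ` ?E"
      then obtain x y where xy: "x \<in> L" "y \<in> R" "d = edge_label f (x, y)" by auto
      then have "d = int (f y) - int (f x)"
        using less[OF f, of x y] by (simp add: edge_label_def)
      then show "d \<in> ?D" using xy by blast
    qed
    ultimately show ?thesis
      using bij[OF f] by (simp add: \<phi>_def label_set_pairs_def bij_betw_def)
  qed
  have img2: "\<exists>f\<in>?A. \<phi> f = (S, T)" if ST: "(S, T) \<in> label_set_pairs a b" for S T
  proof -
    have S: "S \<subseteq> {0..a * b}" "card S = a" and T: "T \<subseteq> {0..a * b}" "card T = b"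
      and D: "{int y - int x | x y. x \<in> S \<and> y \<in> T} = {1..int (a * b)}"
      using ST by (auto simp: label_set_pairs_def)
    have finS: "finite S" "finite T" using S T by (auto intro: finite_subset)
    obtain h where h: "bij_betw h L S" using finite_same_card_bij[OF fin(1) finS(1)] cL S by auto
    obtain k where k: "bij_betw k R T" using finite_same_card_bij[OF fin(2) finS(2)] cR T by auto
    define f where "f v = (if v \<in> L then h v else if v \<in> R then k v else undefined)" for v
    have fL: "f ` L = S" using h by (auto simp: f_def bij_betw_def)
    have fR: "f ` R = T" using k disj by (auto simp: f_def bij_betw_def image_iff)
    have lt: "f x < f y" if "x \<in> L" "y \<in> R" for x y
    proof -
      have "int (f y) - int (f x) \<in> {1..int (a * b)}"
        unfolding D[symmetric] using that fL fR by blast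
      then show ?thesis by simp
    qed
    have im: "edge_label f ` ?E = {1..int (a * b)}"
      unfolding D[symmetric]
    proof (intro equalityI subsetI)
      fix d assume "d \<in> edge_label f ` ?E"
      then obtain x y where xy: "x \<in> L" "y \<in> R" "d = edge_label f (x, y)" by auto
      then have "d = int (f y) - int (f x)" using lt[of x y] by (simp add: edge_label_def)
      then show "d \<in> {int y - int x | x y. x \<in> S \<and> y \<in> T}" using xy fL fR by blast
    next
      fix d assume "d \<in> {int y - int x | x y. x \<in> S \<and> y \<in> T}"
      then obtain x y where "x \<in> L" "y \<in> R" "d = int (f y) - int (f x)"
        using fL fR by blast
      then show "d \<in> edge_label f ` ?E"
        using lt[of x y] by (intro image_eqI[of _ _ "(x, y)"]) (auto simp: edge_label_def)
    qed
    have "inj_on (edge_label f) ?E"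
      by (rule eq_card_imp_inj_on) (use fin cE im in \<open>auto simp: nat_mult_distrib\<close>)
    then have "bij_betw (edge_label f) ?E {1..int (card ?E)}"
      using im cE by (simp add: bij_betw_def)
    moreover have "f \<in> (L \<union> R) \<rightarrow>\<^sub>E {0..card ?E}"
    proof (rule PiE_I)
      fix v assume "v \<in> L \<union> R"
      then have "f v \<in> S \<union> T" using fL fR by blast
      then show "f v \<in> {0..card ?E}" using S T cE by auto
    qed (simp add: f_def)
    ultimately have "f \<in> ?A" using lt by (auto simp: alpha_graceful_labelings_def)
    then show ?thesis using fL fR by (auto simp: \<phi>_def)
  qed
  have eqv: "equiv ?A ?r" by (rule equiv_essentially_same)
  have cls: "\<phi> ` C = {\<phi> f}" if "f \<in> ?A" "C = ?r `` {f}" for f C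
  proof -
    have "f \<in> C" using equiv_class_self[OF eqv that(1)] that(2) by simp
    moreover have "\<phi> g = \<phi> f" if "g \<in> C" for g using inv[of f g] that \<open>C = ?r `` {f}\<close> by simp
    ultimately show ?thesis by blast
  qed
  have "bij_betw (\<lambda>C. the_elem (\<phi> ` C)) (?A // ?r) (label_set_pairs a b)"
  proof (rule bij_betw_imageI[OF inj_onI subset_antisym[OF subsetI subsetI]])
    fix C D assume "C \<in> ?A // ?r" "D \<in> ?A // ?r" and e: "the_elem (\<phi> ` C) = the_elem (\<phi> ` D)"
    then obtain f g where f: "f \<in> ?A" "C = ?r `` {f}" and g: "g \<in> ?A" "D = ?r `` {g}"
      by (auto elim!: quotientE)
    have "\<phi> f = \<phi> g" using e cls[OF f] cls[OF g] by simp
    then show "C = D" using conv[OF f(1) g(1)] f g equiv_class_eq[OF eqv] by blast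
  next
    fix p assume "p \<in> (\<lambda>C. the_elem (\<phi> ` C)) ` (?A // ?r)"
    then obtain f C where f: "f \<in> ?A" "C = ?r `` {f}" "p = the_elem (\<phi> ` C)"
      by (auto elim!: quotientE)
    then show "p \<in> label_set_pairs a b" using img1[OF f(1)] cls[OF f(1,2)] by simp
  next
    fix p assume p: "p \<in> label_set_pairs a b"
    obtain f where f: "f \<in> ?A" "\<phi> f = p"
      using img2[of "fst p" "snd p"] p by (metis prod.collapse)
    then show "p \<in> (\<lambda>C. the_elem (\<phi> ` C)) ` (?A // ?r)"
      using cls[OF f(1) refl] by (intro image_eqI[of _ _ "?r `` {f}"]) (auto intro: quotientI)
  qed
  then have "card (?A // ?r) = card (label_set_pairs a b)" by (rule bij_betw_same_card)
  then show ?thesis by (simp add: num_alpha_def Let_def L_def R_def)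
qed

end

theory Submission
  imports Defs "HOL-Computational_Algebra.Polynomial"
    "HOL-Computational_Algebra.Formal_Power_Series"
begin

text \<open>
  Reversing and shifting the two label sets turns a pair \<open>(S', S'')\<close> into a tiling
  \<open>A \<oplus> B = {0..<a b}\<close>. By de Bruijn's argument the factor containing \<open>1\<close> is built from blocks whose
  length \<open>f > 1\<close> divides its size, while the other factor consists of multiples of \<open>f\<close>. Removing a
  prime from \<open>f\<close> and using inclusion-exclusion over the two primes available on each side gives for
  the numbers of tilings with sizes \<open>p\<^sub>1\<^sup>i p\<^sub>2\<^sup>j\<close> and \<open>q\<^sub>1\<^sup>k q\<^sub>2\<^sup>l\<close> the generating function
  \<open>1 / (1 - s - t + st - u - v + uv)\<close>. Its diagonal coefficient is
  \<open>C(2n, n) \<Sum>\<^sub>k C(2n, n - k)\<^sup>2 C(2n + k, k)\<close>. The alternating sum of fourth powers takes the same value: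
  expand each \<open>C(2n, i)\<^sup>2\<close> along \<open>\<Sum>\<^sub>i C(2n, i)\<^sup>2 y\<^sup>i = \<Sum>\<^sub>k C(2n, 2k) C(2k, k) y\<^sup>k (1 + y)\<^bsup>2n - 2k\<^esup>\<close>,
  evaluate the resulting middle coefficients of \<open>(1 + y)\<^bsup>2a\<^esup> (1 - y)\<^bsup>2b\<^esup>\<close> by von Szily's identity and
  apply Vandermonde's convolution.
\<close>

section \<open>Tilings of an interval\<close>

definition tiles :: "nat set \<Rightarrow> nat set \<Rightarrow> nat \<Rightarrow> bool" where
  "tiles A B N \<longleftrightarrow> bij_betw (\<lambda>(x, y). x + y) (A \<times> B) {..<N}"

lemma tilesI:
  assumes "\<And>x y. x \<in> A \<Longrightarrow> y \<in> B \<Longrightarrow> x + y < N"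
    and "\<And>z. z < N \<Longrightarrow> \<exists>x\<in>A. \<exists>y\<in>B. z = x + y"
    and "\<And>x y x' y'. x \<in> A \<Longrightarrow> y \<in> B \<Longrightarrow> x' \<in> A \<Longrightarrow> y' \<in> B \<Longrightarrow> x + y = x' + y' \<Longrightarrow> x = x' \<and> y = y'"
  shows "tiles A B N"
  unfolding tiles_def
proof (rule bij_betw_imageI)
  show "inj_on (\<lambda>(x, y). x + y) (A \<times> B)"
    by (rule inj_onI) (use assms(3) in auto)
  show "(\<lambda>(x, y). x + y) ` (A \<times> B) = {..<N}"
    using assms(1,2) by (fastforce simp: image_iff)
qed

lemma tiles_less: "tiles A B N \<Longrightarrow> x \<in> A \<Longrightarrow> y \<in> B \<Longrightarrow> x + y < N"
  unfolding tiles_def by (fastforce dest: bij_betwE)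

lemma tilesE:
  assumes "tiles A B N" "z < N"
  obtains x y where "x \<in> A" "y \<in> B" "z = x + y"
proof -
  have "z \<in> (\<lambda>(x, y). x + y) ` (A \<times> B)"
    using assms by (simp add: tiles_def bij_betw_def)
  then show ?thesis using that by auto
qed

lemma tiles_unique:
  assumes "tiles A B N" "x \<in> A" "y \<in> B" "x' \<in> A" "y' \<in> B" "x + y = x' + y'"
  shows "x = x' \<and> y = y'"
  using inj_onD[OF bij_betw_imp_inj_on[OF assms(1)[unfolded tiles_def]], of "(x, y)" "(x', y')"] assms
  by simp

lemma tiles_commute: "tiles A B N \<Longrightarrow> tiles B A N"
  by (rule tilesI) (metis add.commute tiles_less, metis add.commute tilesE, metis add.commute tiles_unique)

lemma tiles_zero:
  assumes "tiles A B N" "N > 0"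
  shows "0 \<in> A" "0 \<in> B"
  using tilesE[OF assms] by auto

lemma tiles_subset:
  assumes "tiles A B N" "N > 0"
  shows "A \<subseteq> {..<N}" "B \<subseteq> {..<N}"
  using tiles_less[OF assms(1)] tiles_zero[OF assms] by fastforce+

lemma tiles_card: "tiles A B N \<Longrightarrow> card A * card B = N"
  using bij_betw_same_card[of _ "A \<times> B" "{..<N}"] by (simp add: tiles_def card_cartesian_product)

text \<open>Greedy reconstruction of \<open>A\<close> from \<open>B\<close>: since
  \<open>0 \<in> B\<close>, a member \<open>x = x + 0\<close> that a smaller member of
  \<open>A\<close> already covers would have two decompositions.\<close>

lemma tiles_left_mem_iff:
  assumes "tiles A B N" "N > 0"
  shows "x \<in> A \<longleftrightarrow> x < N \<and> (\<forall>u<x. \<forall>y\<in>B. u \<in> A \<longrightarrow> x \<noteq> u + y)"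
proof
  assume x: "x \<in> A"
  then have "x < N" using tiles_subset[OF assms] by blast
  moreover have False if "u < x" "y \<in> B" "u \<in> A" "x = u + y" for u y
    using tiles_unique[OF assms(1) x tiles_zero(2)[OF assms] that(3,2)] that by simp
  ultimately show "x < N \<and> (\<forall>u<x. \<forall>y\<in>B. u \<in> A \<longrightarrow> x \<noteq> u + y)" by blast
next
  assume x: "x < N \<and> (\<forall>u<x. \<forall>y\<in>B. u \<in> A \<longrightarrow> x \<noteq> u + y)"
  then obtain u y where "u \<in> A" "y \<in> B" "x = u + y"
    using tilesE[OF assms(1)] by blast
  moreover from this x have "y = 0"
    by (metis gr0I less_add_same_cancel1)
  ultimately show "x \<in> A" by simp
qed

text \<open>Strong induction along the greedy criterion. Tilings can therefore be counted by their
  right factors alone.\<close>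

lemma tiles_left_unique:
  assumes "tiles A B N" "tiles A' B N" "N > 0"
  shows "A = A'"
proof -
  have "x \<in> A \<longleftrightarrow> x \<in> A'" for x
  proof (induction x rule: less_induct)
    case (less x)
    then show ?case
      unfolding tiles_left_mem_iff[OF assms(1,3), of x] tiles_left_mem_iff[OF assms(2,3), of x] by blast
  qed
  then show ?thesis by blast
qed

text \<open>If \<open>d\<close> divides both \<open>y\<close> and \<open>x + y\<close>, it divides
  \<open>x\<close>. So multiples of \<open>d\<close> are covered using only the multiples of
  \<open>d\<close> in \<open>A\<close>; the other elements of \<open>A\<close> are dropped.\<close>

lemma tiles_div:
  assumes "tiles A B (d * N)" "\<forall>y\<in>B. d dvd y" "d > 0"
  shows "tiles {x. d * x \<in> A} {y. d * y \<in> B} N"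
proof (rule tilesI)
  fix x y assume "x \<in> {x. d * x \<in> A}" "y \<in> {y. d * y \<in> B}"
  then have "d * (x + y) < d * N"
    using tiles_less[OF assms(1)] by (simp add: distrib_left)
  then show "x + y < N" by simp
next
  fix z assume "z < N"
  then have "d * z < d * N" using assms(3) by simp
  then obtain x y where xy: "x \<in> A" "y \<in> B" "d * z = x + y"
    using tilesE[OF assms(1)] by blast
  then have "d dvd x" "d dvd y"
    using assms(2) by (metis dvd_add_left_iff dvd_triv_left, blast)
  then obtain x' y' where "x = d * x'" "y = d * y'" by (auto elim!: dvdE)
  with xy assms(3) show "\<exists>x\<in>{x. d * x \<in> A}. \<exists>y\<in>{y. d * y \<in> B}. z = x + y"
    by (auto simp flip: distrib_left)
next
  fix x y x' y' assume "x \<in> {x. d * x \<in> A}" "y \<in> {y. d * y \<in> B}" "x' \<in> {x. d * x \<in> A}"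
    "y' \<in> {y. d * y \<in> B}" "x + y = x' + y'"
  then show "x = x' \<and> y = y'"
    using tiles_unique[OF assms(1), of "d * x" "d * y" "d * x'" "d * y'"] assms(3)
    by (simp flip: distrib_left)
qed

text \<open>Each point of \<open>A\<close> is blown up to a block of \<open>d\<close> consecutive
  integers. The blocks absorb remainders modulo \<open>d\<close>, while quotients are decomposed by
  the old tiling.\<close>

lemma tiles_scale:
  assumes "tiles A B N" "d > 0"
  shows "tiles {x. x div d \<in> A} ((*) d ` B) (d * N)"
proof (rule tilesI)
  fix x y assume "x \<in> {x. x div d \<in> A}" "y \<in> (*) d ` B"
  then obtain y' where y': "y' \<in> B" "y = d * y'" and "x div d \<in> A" by auto
  then have "(x + y) div d < N"
    using tiles_less[OF assms(1), of "x div d" y'] assms(2) by simp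
  then show "x + y < d * N"
    using assms(2) by (simp add: div_less_iff_less_mult mult.commute)
next
  fix z assume "z < d * N"
  then have "z div d < N"
    using assms(2) by (simp add: div_less_iff_less_mult mult.commute)
  then obtain x y where xy: "x \<in> A" "y \<in> B" "z div d = x + y"
    using tilesE[OF assms(1)] by blast
  have "z = d * (x + y) + z mod d"
    by (simp flip: xy(3))
  then have "z = (d * x + z mod d) + d * y"
    by (simp add: algebra_simps)
  moreover have "d * x + z mod d \<in> {x. x div d \<in> A}"
    using xy assms(2) by simp
  ultimately show "\<exists>x\<in>{x. x div d \<in> A}. \<exists>y\<in>(*) d ` B. z = x + y"
    using xy(2) by blast
next
  fix x y x' y' assume x: "x \<in> {x. x div d \<in> A}" "x' \<in> {x. x div d \<in> A}" and eq: "x + y = x' + y'"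
    and "y \<in> (*) d ` B" "y' \<in> (*) d ` B"
  then obtain v v' where v: "v \<in> B" "y = d * v" "v' \<in> B" "y' = d * v'" by auto
  have "x div d + v = (x + y) div d" "x' div d + v' = (x' + y') div d"
    using v assms(2) by simp_all
  then have "v = v'"
    using tiles_unique[OF assms(1), of "x div d" v "x' div d" v'] x v eq by simp
  then show "x = x' \<and> y = y'" using eq v by simp
qed

text \<open>The key step of de Bruijn's structure theorem for tilings of an interval.\<close>

lemma tiles_blocks:
  assumes t: "tiles A B N" and N: "N > 0" and f: "f \<in> B" "f > 0"
    and least: "\<And>y. y \<in> B \<Longrightarrow> 0 < y \<Longrightarrow> f \<le> y" and r: "r < f"
  shows "(f * m + r \<in> A \<longleftrightarrow> f * m \<in> A) \<and> (f * m + r \<in> B \<longrightarrow> r = 0)"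
  using r
proof (induction m arbitrary: r rule: less_induct)
  case (less m r)
  note zero = tiles_zero[OF t N] and unique = tiles_unique[OF t]
  note less_N = tiles_less[OF t]
  \<comment> \<open>Blocks of length \<open>f\<close> before \<open>f * m\<close> are already known
    to lie wholly inside or wholly outside \<open>A\<close>.\<close>
  have below_A: "f * (x div f) + s \<in> A" if "x \<in> A" "x < f * m" "s < f" for x s
    using less.IH[of "x div f" "x mod f"] less.IH[of "x div f" s] that f(2)
    by (simp add: div_less_iff_less_mult mult.commute)
  have below_B: "f dvd y" if "y \<in> B" "y < f * m" for y
    using less.IH[of "y div f" "y mod f"] that f(2)
    by (simp add: div_less_iff_less_mult mult.commute mod_eq_0_iff_dvd)
  \<comment> \<open>The right part of a number below \<open>f\<close> must be \<open>0\<close>,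
    because \<open>f\<close> is the least positive element of \<open>B\<close>.\<close>
  have small: "s \<in> A" if s: "s < f" for s
  proof -
    have "s < N" using s less_N[OF zero(1) f(1)] by simp
    then obtain x y where "x \<in> A" "y \<in> B" "s = x + y" using tilesE[OF t] by blast
    then show ?thesis using least[of y] s by (cases "y = 0") auto
  qed
  show ?case
  proof (cases "r = 0")
    case False
    consider "N \<le> f * m" | "f * m \<in> A" | "f * m \<notin> A" "f * m \<in> B"
      | "f * m \<notin> A" "f * m \<notin> B" "f * m < N"
      by linarith
    then show ?thesis
    proof cases
      case 1
      then show ?thesis
        using less_N[OF _ zero(2), of "f * m + r"] less_N[OF _ zero(2), of "f * m"]
          less_N[OF zero(1), of "f * m + r"] by auto
    next
      case 2
      have "f * m + r < N"
        using less_N[OF 2 f(1)] less.prems by simp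
      then obtain x y where xy: "x \<in> A" "y \<in> B" "f * m + r = x + y"
        using tilesE[OF t] by blast
      have "y = 0"
      proof (rule ccontr)
        assume "y \<noteq> 0"
        then have "f \<le> y" using least xy(2) by simp
        then have "x < f * m" using xy(3) less.prems by linarith
        show False
        proof (cases "y < f * m")
          case True
          then obtain k where "y = f * k" using below_B xy(2) by blast
          \<comment> \<open>\<open>x\<close> has offset \<open>r\<close> in its block; moving it to
            the start of the block gives \<open>f * m = f * (x div f) + y\<close>, a rival to
            \<open>f * m + 0\<close>.\<close>
          then have "(x + f * k) mod f = (f * m + r) mod f"
            using xy(3) by simp
          then have "x mod f = r" using less.prems by simp
          then have "x = f * (x div f) + r" by (metis mult_div_mod_eq)
          then have "f * (x div f) + y = f * m + 0" using xy(3) by linarith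
          then have "y = 0"
            using unique[OF below_A[OF xy(1) \<open>x < f * m\<close> f(2)] xy(2), of "f * m" 0] 2 zero by simp
          with \<open>y \<noteq> 0\<close> show False ..
        next
          case False
          then obtain u where u: "y = f * m + u" using le_Suc_ex not_less by blast
          then have "u < f" using xy(3) less.prems by linarith
          have "m > 0" using u \<open>f \<le> y\<close> \<open>u < f\<close> by (cases m) auto
          then have "f \<le> f * m" by simp
          show False
          proof (cases "u = 0")
            case True
            then show False using unique[OF 2 zero(2) zero(1) xy(2)] u \<open>y \<noteq> 0\<close> by simp
          next
            case False
            \<comment> \<open>\<open>(f - u) + y\<close> and \<open>f * m + f\<close> are
              decompositions of the same number.\<close>
            then have "f - u = f * m"
              using unique[OF small[of "f - u"] xy(2) 2 f(1)] u \<open>u < f\<close> f(2) by simp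
            then show False using \<open>f \<le> f * m\<close> False f(2) by linarith
          qed
        qed
      qed
      then have "f * m + r \<in> A" using xy by simp
      moreover have "f * m + r \<notin> B"
        using unique[OF \<open>f * m + r \<in> A\<close> zero(2) zero(1), of "f * m + r"] False by auto
      ultimately show ?thesis using 2 by simp
    next
      case 3
      then have "f * m \<noteq> 0" using zero(1) by metis
      \<comment> \<open>\<open>r + f * m\<close> is a decomposition with both parts positive, which
        keeps its value out of both factors.\<close>
      have "r \<in> A" using small less.prems .
      then have "f * m + r \<notin> A"
        using unique[of "f * m + r" 0 r "f * m"] zero(2) \<open>r \<in> A\<close> 3(2) \<open>f * m \<noteq> 0\<close> by auto
      moreover have "f * m + r \<notin> B"
        using unique[of 0 "f * m + r" r "f * m"] zero(1) \<open>r \<in> A\<close> 3(2) False by auto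
      ultimately show ?thesis using 3 by simp
    next
      case 4
      then obtain x y where xy: "x \<in> A" "y \<in> B" "f * m = x + y"
        using tilesE[OF t] by blast
      then have "x \<noteq> 0" "y \<noteq> 0" using 4 by (metis add_0, metis add_0_right)
      then have "x < f * m" "f dvd y" using xy below_B by auto
      then have "f dvd x" using xy(3) by (metis dvd_add_left_iff dvd_triv_left)
      \<comment> \<open>\<open>x\<close> starts a block of \<open>A\<close>, so shifting it by
        \<open>r\<close> decomposes \<open>f * m + r\<close> with both parts positive.\<close>
      then have "x + r \<in> A"
        using below_A[OF xy(1) \<open>x < f * m\<close> less.prems] by simp
      moreover have "f * m + r = (x + r) + y" using xy by simp
      ultimately have "f * m + r \<notin> A" "f * m + r \<notin> B"
        using unique[OF _ zero(2) _ xy(2)] unique[OF zero(1) _ _ xy(2)] \<open>x \<noteq> 0\<close> \<open>y \<noteq> 0\<close>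
        by fastforce+
      then show ?thesis using 4 by simp
    qed
  qed (use less.IH in simp)
qed

text \<open>For \<open>f\<close> the least positive element of \<open>B\<close>, the block lemma
  makes \<open>A\<close> a disjoint union of blocks of length \<open>f\<close> and \<open>B\<close>
  a set of multiples of \<open>f\<close>. \<open>1 \<in> A\<close> excludes
  \<open>f = 1\<close>.\<close>

lemma tiles_one_mem:
  assumes t: "tiles A B N" and "1 \<in> A" "N > 0"
  obtains f where "f > 1" "f dvd card A" "\<forall>y\<in>B. f dvd y"
proof (cases "B = {0}")
  \<comment> \<open>\<open>B\<close> has no positive element; \<open>A\<close> is a single block,
    whose length serves as \<open>f\<close>.\<close>
  case True
  then have "card A = N" using tiles_card[OF t] by simp
  moreover have "1 < N" using tiles_subset[OF t \<open>N > 0\<close>] \<open>1 \<in> A\<close> by auto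
  ultimately show thesis using that[of "card A"] True by simp
next
  case False
  note zero = tiles_zero[OF t \<open>N > 0\<close>]
  define f where "f = (LEAST y. y \<in> B \<and> 0 < y)"
  have "\<exists>y. y \<in> B \<and> 0 < y" using False zero by auto
  then have f: "f \<in> B" "f > 0" unfolding f_def by (metis (mono_tags, lifting) LeastI_ex)+
  have least: "f \<le> y" if "y \<in> B" "0 < y" for y
    unfolding f_def using that by (simp add: Least_le)
  have block: "(x \<in> A \<longleftrightarrow> f * (x div f) \<in> A) \<and> (x \<in> B \<longrightarrow> x mod f = 0)" for x
    using tiles_blocks[OF t \<open>N > 0\<close> f least, of "x mod f" "x div f"] f(2) by simp
  have "f \<noteq> 1"
    using tiles_unique[OF t \<open>1 \<in> A\<close> zero(2) zero(1) f(1)] by auto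
  moreover have "bij_betw (\<lambda>(x, r). f * x + r) ({x. f * x \<in> A} \<times> {..<f}) A"
  proof (rule bij_betwI[where g = "\<lambda>x. (x div f, x mod f)"])
    show "(\<lambda>(x, r). f * x + r) \<in> {x. f * x \<in> A} \<times> {..<f} \<rightarrow> A"
    proof (rule funcsetI, clarify)
      fix x r assume "f * x \<in> A" "r < f"
      then show "f * x + r \<in> A" using block[of "f * x + r"] by simp
    qed
    show "(\<lambda>x. (x div f, x mod f)) \<in> A \<rightarrow> {x. f * x \<in> A} \<times> {..<f}"
    proof (rule funcsetI)
      fix x assume "x \<in> A"
      then show "(x div f, x mod f) \<in> {x. f * x \<in> A} \<times> {..<f}"
        using block[of x] f(2) by simp
    qed
  qed auto
  then have "card ({x. f * x \<in> A} \<times> {..<f}) = card A"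
    by (rule bij_betw_same_card)
  then have "f dvd card A"
    by (metis card_cartesian_product card_lessThan dvd_triv_right)
  ultimately show thesis using that[of f] f(2) block by (simp add: mod_eq_0_iff_dvd)
qed

section \<open>Recursion for the number of tilings of given sizes\<close>

definition tilings :: "nat \<Rightarrow> nat \<Rightarrow> (nat set \<times> nat set) set" where
  "tilings a b = {(A, B). card A = a \<and> card B = b \<and> tiles A B (a * b)}"

lemma finite_tilings:
  assumes "a > 0" "b > 0"
  shows "finite (tilings a b)"
proof (rule finite_subset)
  show "tilings a b \<subseteq> Pow {..<a * b} \<times> Pow {..<a * b}"
    using assms tiles_subset by (fastforce simp: tilings_def)
qed simp

lemma card_tilings_one: "card (tilings 1 1) = 1"
proof -
  have "tilings 1 1 = {({0}, {0})}"
  proof (intro equalityI subsetI)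
    fix t assume "t \<in> tilings 1 1"
    then obtain A B where t: "t = (A, B)" "card A = 1" "card B = 1" "tiles A B 1"
      by (auto simp: tilings_def)
    then have "0 \<in> A" "0 \<in> B" using tiles_zero[OF t(4)] by auto
    then show "t \<in> {({0}, {0})}" using t by (auto simp: card_1_singleton_iff)
  qed (auto simp: tilings_def intro!: tilesI)
  then show ?thesis by simp
qed

text \<open>The tilings whose left factor begins with a block of length divisible by \<open>d\<close>.\<close>

definition div_tilings :: "nat \<Rightarrow> nat \<Rightarrow> nat \<Rightarrow> (nat set \<times> nat set) set" where
  "div_tilings d a b = {(A, B) \<in> tilings a b. \<forall>y\<in>B. d dvd y}"

text \<open>Contraction and dilation by \<open>d\<close> match the right factors of the two
  families, and right factors determine tilings.\<close>

lemma card_div_tilings: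
  assumes "d > 0" "a > 0" "b > 0"
  shows "card (div_tilings d (d * a) b) = card (tilings a b)"
proof -
  have inj: "inj_on snd (tilings c b)" if "c > 0" for c
  proof (rule inj_onI)
    fix t u assume "t \<in> tilings c b" "u \<in> tilings c b" "snd t = snd u"
    then obtain A A' B where t: "t = (A, B)" "u = (A', B)" "tiles A B (c * b)" "tiles A' B (c * b)"
      by (cases t, cases u) (simp add: tilings_def)
    moreover have "c * b > 0" using that \<open>b > 0\<close> by simp
    ultimately show "t = u" using tiles_left_unique by blast
  qed
  have "snd ` div_tilings d (d * a) b = (`) ((*) d) ` snd ` tilings a b"
  proof (intro equalityI subsetI)
    fix B assume "B \<in> snd ` div_tilings d (d * a) b"
    then obtain A where A: "card A = d * a" "card B = b" "tiles A B (d * (a * b))" and dvd: "\<forall>y\<in>B. d dvd y"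
      by (auto simp: div_tilings_def tilings_def mult.assoc)
    let ?A = "{x. d * x \<in> A}" and ?B = "{y. d * y \<in> B}"
    have B: "B = (*) d ` ?B" using dvd by (auto simp: image_iff dvd_def)
    have "inj_on ((*) d) ?B" using \<open>d > 0\<close> by (auto intro: inj_onI)
    then have "card ?B = b" using A(2) card_image B by metis
    moreover have t: "tiles ?A ?B (a * b)" by (rule tiles_div[OF A(3) dvd \<open>d > 0\<close>])
    ultimately have "card ?A = a" using tiles_card[OF t] \<open>b > 0\<close> by simp
    then have "(?A, ?B) \<in> tilings a b" using t \<open>card ?B = b\<close> by (simp add: tilings_def)
    then show "B \<in> (`) ((*) d) ` snd ` tilings a b" using B by (metis imageI snd_conv)
  next
    fix B assume "B \<in> (`) ((*) d) ` snd ` tilings a b"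
    then obtain A C where C: "B = (*) d ` C" "card C = b" "tiles A C (a * b)"
      by (auto simp: tilings_def)
    have t: "tiles {x. x div d \<in> A} B (d * a * b)"
      unfolding C mult.assoc by (rule tiles_scale[OF C(3) \<open>d > 0\<close>])
    have "card B = b" unfolding C(1) using C(2) \<open>d > 0\<close> by (subst card_image) (auto intro: inj_onI)
    moreover have "card {x. x div d \<in> A} = d * a"
      using tiles_card[OF t] \<open>card B = b\<close> \<open>b > 0\<close> by simp
    ultimately have "({x. x div d \<in> A}, B) \<in> div_tilings d (d * a) b"
      using t C(1) by (auto simp: div_tilings_def tilings_def)
    then show "B \<in> snd ` div_tilings d (d * a) b" by force
  qed
  moreover have "inj ((`) ((*) d))"
  proof (rule injI)
    fix B C assume "(*) d ` B = (*) d ` C"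
    moreover have "inj ((*) d)" using \<open>d > 0\<close> by (auto intro: injI)
    ultimately show "B = C" by (simp add: inj_image_eq_iff)
  qed
  ultimately have "card (snd ` div_tilings d (d * a) b) = card (snd ` tilings a b)"
    by (metis card_image inj_on_subset subset_UNIV)
  moreover have "card (snd ` div_tilings d (d * a) b) = card (div_tilings d (d * a) b)"
    using assms by (intro card_image inj_on_subset[OF inj[of "d * a"]]) (auto simp: div_tilings_def)
  ultimately show ?thesis using card_image[OF inj[OF \<open>a > 0\<close>]] by simp
qed

text \<open>For \<open>a * b > 1\<close> these are the tilings with \<open>1\<close> in the left
  factor. Describing them by primes makes inclusion-exclusion applicable.\<close>

definition left_tilings :: "nat \<Rightarrow> nat \<Rightarrow> (nat set \<times> nat set) set" where
  "left_tilings a b = (\<Union>p\<in>{p. prime p \<and> p dvd a}. div_tilings p a b)"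

lemma left_tilings_subset: "left_tilings a b \<subseteq> tilings a b"
  by (auto simp: left_tilings_def div_tilings_def)

lemma tilings_swap: "(A, B) \<in> tilings a b \<longleftrightarrow> (B, A) \<in> tilings b a"
  by (auto simp: tilings_def mult.commute dest: tiles_commute)

lemma tilings_one_mem:
  assumes "(A, B) \<in> tilings a b" "1 \<in> A" "a > 0" "b > 0"
  shows "(A, B) \<in> left_tilings a b"
proof -
  obtain f where "f > 1" "f dvd a" "\<forall>y\<in>B. f dvd y"
    using assms tiles_one_mem[of A B "a * b"] by (auto simp: tilings_def)
  moreover obtain p where "prime p" "p dvd f"
    using \<open>f > 1\<close> by (metis less_not_refl prime_factor_nat)
  ultimately show ?thesis
    using assms(1) by (auto simp: left_tilings_def div_tilings_def intro: dvd_trans)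
qed

lemma left_tilings_one_notin:
  assumes "(A, B) \<in> left_tilings a b"
  shows "1 \<notin> B"
  using assms by (auto simp: left_tilings_def div_tilings_def)

text \<open>As \<open>1 < a * b\<close>, the number \<open>1\<close> lies in exactly one factor;
  exchanging the factors turns the second case into the first.\<close>

lemma card_tilings_split:
  assumes "a > 0" "b > 0" "a * b \<noteq> 1"
  shows "card (tilings a b) = card (left_tilings a b) + card (left_tilings b a)"
proof -
  have "a * b > 0" using assms by simp
  then have "1 < a * b" using \<open>a * b \<noteq> 1\<close> by linarith
  have "tilings a b = left_tilings a b \<union> prod.swap ` left_tilings b a"
  proof (intro equalityI subsetI)
    fix t assume t: "t \<in> tilings a b"
    obtain A B where AB: "t = (A, B)" by fastforce
    obtain x y where xy: "x \<in> A" "y \<in> B" "1 = x + y"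
      using t tilesE[OF _ \<open>1 < a * b\<close>, of A B] by (auto simp: AB tilings_def)
    then have "1 \<in> A \<or> 1 \<in> B" by (cases x) auto
    then show "t \<in> left_tilings a b \<union> prod.swap ` left_tilings b a"
      using tilings_one_mem[of A B a b] tilings_one_mem[of B A b a] t assms
      by (force simp: AB tilings_swap[of B A])
  next
    fix t assume "t \<in> left_tilings a b \<union> prod.swap ` left_tilings b a"
    then show "t \<in> tilings a b"
      using left_tilings_subset tilings_swap by fastforce
  qed
  moreover have "left_tilings a b \<inter> prod.swap ` left_tilings b a = {}"
  proof (rule ccontr)
    assume "left_tilings a b \<inter> prod.swap ` left_tilings b a \<noteq> {}"
    then obtain A B where AB: "(A, B) \<in> left_tilings a b" "(B, A) \<in> left_tilings b a" by auto
    then have "1 \<notin> A" "1 \<notin> B" using left_tilings_one_notin by blast+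
    have t: "tiles A B (a * b)" using AB(1) left_tilings_subset by (fastforce simp: tilings_def)
    obtain x y where xy: "x \<in> A" "y \<in> B" "1 = x + y" using tilesE[OF t \<open>1 < a * b\<close>] by blast
    then show False using \<open>1 \<notin> A\<close> \<open>1 \<notin> B\<close> by (cases x) auto
  qed
  moreover have "finite (left_tilings a b)" "finite (left_tilings b a)"
    using finite_tilings assms left_tilings_subset by (metis finite_subset)+
  moreover have "card (prod.swap ` left_tilings b a) = card (left_tilings b a)"
    by (intro card_image) auto
  ultimately show ?thesis by (simp add: card_Un_disjoint)
qed

text \<open>Inclusion-exclusion over the two possible primes. By coprimality both conditions
  together ask for divisibility by \<open>p * q\<close>, and every term contracts to smaller sizes.
  The guards drop a prime with exponent \<open>0\<close>.\<close>

lemma card_left_tilings: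
  assumes p: "prime p" "prime q" "p \<noteq> q" and b: "b > 0"
  shows "int (card (left_tilings (p ^ i * q ^ j) b)) =
    (if i = 0 then 0 else int (card (tilings (p ^ (i - 1) * q ^ j) b)))
    + (if j = 0 then 0 else int (card (tilings (p ^ i * q ^ (j - 1)) b)))
    - (if i = 0 \<or> j = 0 then 0 else int (card (tilings (p ^ (i - 1) * q ^ (j - 1)) b)))"
proof -
  let ?a = "p ^ i * q ^ j"
  have pos: "p > 0" "q > 0" using p by (auto simp: prime_gt_0_nat)
  define P where "P = (if i = 0 then {} else div_tilings p ?a b)"
  define Q where "Q = (if j = 0 then {} else div_tilings q ?a b)"
  have "r = p \<and> i \<noteq> 0 \<or> r = q \<and> j \<noteq> 0" if "prime r" "r dvd ?a" for r
    using that p by (metis power_0 prime_dvd_mult_nat prime_dvd_power_nat primes_dvd_imp_eq)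
  moreover have "p dvd ?a" if "i \<noteq> 0" using that by (simp add: dvd_mult2 dvd_power)
  moreover have "q dvd ?a" if "j \<noteq> 0" using that by (simp add: dvd_mult dvd_power)
  ultimately have "{r. prime r \<and> r dvd ?a} = (if i = 0 then {} else {p}) \<union> (if j = 0 then {} else {q})"
    using p by auto
  then have LT: "left_tilings ?a b = P \<union> Q"
    by (simp add: left_tilings_def P_def Q_def)
  have fin: "finite P" "finite Q"
    using finite_subset[OF left_tilings_subset finite_tilings[of ?a b]] pos b unfolding LT by auto
  have cP: "card P = (if i = 0 then 0 else card (tilings (p ^ (i - 1) * q ^ j) b))"
  proof (cases i)
    case (Suc i')
    then show ?thesis
      using card_div_tilings[of p "p ^ i' * q ^ j" b] pos b by (simp add: P_def mult.assoc)
  qed (simp add: P_def)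
  have cQ: "card Q = (if j = 0 then 0 else card (tilings (p ^ i * q ^ (j - 1)) b))"
  proof (cases j)
    case (Suc j')
    then show ?thesis
      using card_div_tilings[of q "p ^ i * q ^ j'" b] pos b by (simp add: Q_def mult.left_commute)
  qed (simp add: Q_def)
  have cPQ: "card (P \<inter> Q) = (if i = 0 \<or> j = 0 then 0 else card (tilings (p ^ (i - 1) * q ^ (j - 1)) b))"
  proof (cases "i = 0 \<or> j = 0")
    case False
    then obtain i' j' where ij: "i = Suc i'" "j = Suc j'" by (metis not0_implies_Suc)
    have "coprime p q" using p by (simp add: primes_coprime)
    then have "p dvd y \<and> q dvd y \<longleftrightarrow> p * q dvd y" for y
      by (auto intro: divides_mult dvd_mult_left dvd_mult_right)
    then have "P \<inter> Q = div_tilings (p * q) ((p * q) * (p ^ i' * q ^ j')) b"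
      by (auto simp: P_def Q_def ij div_tilings_def ac_simps)
    then show ?thesis
      using card_div_tilings[of "p * q" "p ^ i' * q ^ j'" b] pos b ij by simp
  qed (auto simp: P_def Q_def)
  have "card P + card Q = card (P \<union> Q) + card (P \<inter> Q)"
    by (rule card_Un_Int[OF fin])
  then have "int (card (left_tilings ?a b)) = int (card P) + int (card Q) - int (card (P \<inter> Q))"
    unfolding LT by simp
  then show ?thesis
    unfolding cP cQ cPQ by simp
qed

section \<open>The generating function\<close>

unbundle fps_syntax

lemma geometric_fps_power:
  fixes c :: "'a::comm_ring_1"
  shows "Abs_fps (\<lambda>k. c ^ Suc k) ^ Suc r = Abs_fps (\<lambda>k. of_nat ((r + k) choose k) * c ^ (Suc r + k))"
proof (induction r)
  case 0
  then show ?case by simp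
next
  case (Suc r)
  have "(Abs_fps (\<lambda>k. c ^ Suc k) ^ Suc (Suc r)) $ k
      = of_nat ((Suc r + k) choose k) * c ^ (Suc (Suc r) + k)" for k
  proof -
    have "(Abs_fps (\<lambda>k. c ^ Suc k) ^ Suc (Suc r)) $ k
        = (\<Sum>i=0..k. (of_nat ((r + i) choose i) * c ^ (Suc r + i)) * c ^ Suc (k - i))"
      by (subst power_Suc2, subst Suc.IH) (simp add: fps_mult_nth)
    also have "\<dots> = (\<Sum>i=0..k. of_nat ((r + i) choose i) * c ^ (Suc (Suc r) + k))"
      by (intro sum.cong refl) (simp add: mult.assoc flip: power_add power_Suc)
    also have "\<dots> = of_nat (\<Sum>i\<le>k. (r + i) choose i) * c ^ (Suc (Suc r) + k)"
      by (simp add: sum_distrib_right atMost_atLeast0)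
    finally show ?thesis by (simp add: sum_choose_lower)
  qed
  then show ?case by (simp add: fps_eq_iff)
qed

lemma one_minus_fps_X_power_nth:
  "((1 - fps_X) ^ n :: 'a::comm_ring_1 fps) $ k = (-1) ^ k * of_nat (n choose k)"
proof (induction n arbitrary: k)
  case 0
  then show ?case by (cases k) auto
next
  case (Suc n)
  have "((1 - fps_X) ^ Suc n :: 'a fps) = (1 - fps_X) ^ n - fps_X * (1 - fps_X) ^ n"
    by (simp add: algebra_simps)
  then show ?case by (cases k) (simp_all add: Suc.IH algebra_simps)
qed

lemma one_minus_fps_X_geometric:
  "(1 - fps_X) * Abs_fps (\<lambda>k. 1 ^ Suc k :: 'a::comm_ring_1) = 1"
  by (rule fps_ext) (auto simp: algebra_simps)

text \<open>Only \<open>i\<close> and \<open>k\<close> become power series variables;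
  \<open>j\<close> and \<open>l\<close> stay indices of \<open>G\<close>. A closed form for
  \<open>G\<close> then leaves a coefficient extraction in two variables.\<close>

lemma diagonal_coefficient:
  fixes N :: "nat \<Rightarrow> nat \<Rightarrow> nat \<Rightarrow> nat \<Rightarrow> int"
  assumes rec: "\<And>i j k l. N i j k l = (if i = 0 \<and> j = 0 \<and> k = 0 \<and> l = 0 then 1 else 0)
      + (if i = 0 then 0 else N (i - 1) j k l) + (if j = 0 then 0 else N i (j - 1) k l)
      - (if i = 0 \<or> j = 0 then 0 else N (i - 1) (j - 1) k l)
      + (if k = 0 then 0 else N i j (k - 1) l) + (if l = 0 then 0 else N i j k (l - 1))
      - (if k = 0 \<or> l = 0 then 0 else N i j (k - 1) (l - 1))"
  shows "N n n n n = int ((2 * n) choose n) *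
    (\<Sum>m\<le>n. (-1) ^ (n - m) * int (n choose m) * int ((2 * n + m) choose m) * int ((2 * n + m) choose n))"
proof -
  \<comment> \<open>\<open>s\<close> lifts the inner variable, which counts \<open>i\<close>, to the
    outer ring, whose own \<open>fps_X\<close> counts \<open>k\<close>. \<open>I\<close> is the
    inverse of the inner \<open>1 - fps_X\<close>, and \<open>W\<close> that of
    \<open>1 - s - fps_X\<close>.\<close>
  define s :: "int fps fps" where "s = fps_const fps_X"
  define I :: "int fps" where "I = Abs_fps (\<lambda>k. 1 ^ Suc k)"
  define W :: "int fps fps" where "W = Abs_fps (\<lambda>k. I ^ Suc k)"
  define G where "G j l = Abs_fps (\<lambda>k. Abs_fps (\<lambda>i. N i j k l))" for j l
  have I: "(1 - fps_X) * I = 1"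
    unfolding I_def by (rule one_minus_fps_X_geometric)
  have W: "(1 - s - fps_X) * W = 1"
  proof (rule fps_ext)
    fix k
    have "((1 - s - fps_X) * W) $ k = (1 - fps_X) * I ^ Suc k - (if k = 0 then 0 else I ^ k)"
      by (cases k) (simp_all add: s_def W_def algebra_simps)
    also have "\<dots> = ((1 - fps_X) * I) * I ^ k - (if k = 0 then 0 else I ^ k)"
      by (simp add: mult.assoc)
    finally show "((1 - s - fps_X) * W) $ k = 1 $ k"
      by (simp add: I)
  qed
  have G_rec: "(1 - s - fps_X) * G j l = (if j = 0 \<and> l = 0 then 1 else 0)
      + (if j = 0 then 0 else (1 - s) * G (j - 1) l)
      + (if l = 0 then 0 else (1 - fps_X) * G j (l - 1))" for j l
  proof (intro fps_ext)
    fix k i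
    show "((1 - s - fps_X) * G j l) $ k $ i = ((if j = 0 \<and> l = 0 then 1 else 0)
      + (if j = 0 then 0 else (1 - s) * G (j - 1) l)
      + (if l = 0 then 0 else (1 - fps_X) * G j (l - 1))) $ k $ i"
      using rec[of i j k l] by (auto simp: G_def s_def left_diff_distrib)
  qed
  \<comment> \<open>Multiplying \<open>G_rec\<close> by \<open>W\<close> adds the contributions of
    \<open>(j - 1, l)\<close> and \<open>(j, l - 1)\<close>; the binomial arises by Pascal's
    rule.\<close>
  have G: "G j l = of_nat ((j + l) choose j) * (1 - s) ^ j * (1 - fps_X) ^ l * W ^ Suc (j + l)" for j l
  proof (induction "j + l" arbitrary: j l)
    case 0
    have "G 0 0 = W * ((1 - s - fps_X) * G 0 0)"
      using W by (simp add: mult.assoc[symmetric] mult.commute)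
    then show ?case using 0 G_rec[of 0 0] by simp
  next
    case (Suc x)
    have *: "G j l = W * ((1 - s - fps_X) * G j l)"
      using W by (simp add: mult.assoc[symmetric] mult.commute)
    consider "j = 0" "l = Suc x" | "l = 0" "j = Suc x"
      | j' l' where "j = Suc j'" "l = Suc l'" "x = Suc (j' + l')"
      using Suc.hyps(2) by (cases j; cases l) auto
    then show ?case
    proof cases
      case 1
      have "G j l = W * ((1 - fps_X) * G 0 x)"
        using 1 by (subst *, subst G_rec) simp
      then show ?thesis
        using 1 Suc.hyps(1)[of 0 x] by (simp add: algebra_simps)
    next
      case 2
      have "G j l = W * ((1 - s) * G x 0)"
        using 2 by (subst *, subst G_rec) simp
      then show ?thesis
        using 2 Suc.hyps(1)[of x 0] by (simp add: algebra_simps)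
    next
      case 3
      have "G j l = W * ((1 - s) * G j' l + (1 - fps_X) * G j l')"
        using 3 by (subst *, subst G_rec) simp
      also have "\<dots> = (of_nat ((j' + l) choose j') + of_nat ((j + l') choose j))
          * (1 - s) ^ j * (1 - fps_X) ^ l * W ^ Suc (j + l)"
      proof -
        have alg: "w * (u * (c * u ^ j' * v ^ l * z) + v * (d * u ^ j * v ^ l' * z))
            = (c + d) * u ^ j * v ^ l * (w * z)" for u v w z c d :: "int fps fps"
          using 3 by (simp add: algebra_simps)
        have "G j' l = of_nat ((j' + l) choose j') * (1 - s) ^ j' * (1 - fps_X) ^ l * W ^ (j + l)"
          and "G j l' = of_nat ((j + l') choose j) * (1 - s) ^ j * (1 - fps_X) ^ l' * W ^ (j + l)"
          using 3 Suc.hyps(1)[of j' l] Suc.hyps(1)[of j l'] by simp_all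
        then show ?thesis by (simp only: alg power_Suc)
      qed
      also have "of_nat ((j' + l) choose j') + of_nat ((j + l') choose j)
          = (of_nat ((j + l) choose j) :: int fps fps)"
        using 3 by (simp flip: of_nat_add)
      finally show ?thesis .
    qed
  qed
  have Ipow: "I ^ Suc r $ k = int ((r + k) choose k)" for r k
    unfolding I_def geometric_fps_power by simp
  have cancel: "(1 - fps_X) ^ n * I ^ (n + r) = I ^ r" for r
    using I by (simp add: power_add mult.assoc[symmetric] power_mult_distrib[symmetric])
  \<comment> \<open>\<open>W ^ Suc (2 * n)\<close> contributes \<open>I ^ (2 * n + m + 1)\<close> at
    index \<open>m\<close>, and \<open>(1 - s) ^ n\<close> cancels \<open>n\<close> of these
    factors.\<close>
  have WI: "((1 - s) ^ n * W ^ Suc (2 * n)) $ m = of_nat ((2 * n + m) choose m) * I ^ Suc (n + m)" for m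
  proof -
    have "(1 - s) ^ n = fps_const ((1 - fps_X) ^ n)"
      by (simp add: s_def fps_const_power[symmetric] flip: fps_const_sub fps_const_1_eq_1)
    then have "((1 - s) ^ n * W ^ Suc (2 * n)) $ m
        = (1 - fps_X) ^ n * (of_nat ((2 * n + m) choose m) * I ^ (n + Suc (n + m)))"
      unfolding W_def geometric_fps_power
      by (simp only: fps_mult_left_const_nth fps_nth_Abs_fps) (simp add: mult_2 add.commute add.left_commute)
    then show ?thesis
      using cancel[of "Suc (n + m)"] by (metis mult.left_commute)
  qed
  have expand: "(P * (1 - fps_X) ^ n) $ n = (\<Sum>m\<le>n. P $ m * ((-1) ^ (n - m) * of_nat (n choose (n - m))))"
    for P :: "int fps fps"
    by (simp add: fps_mult_nth one_minus_fps_X_power_nth atMost_atLeast0)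
  have "N n n n n = G n n $ n $ n"
    by (simp add: G_def)
  also have "G n n = of_nat ((2 * n) choose n) * (((1 - s) ^ n * W ^ Suc (2 * n)) * (1 - fps_X) ^ n)"
    by (simp only: G mult_2) (simp add: ac_simps)
  also have "\<dots> $ n = of_nat ((2 * n) choose n) *
      (\<Sum>m\<le>n. of_nat ((2 * n + m) choose m) * I ^ Suc (n + m) * ((-1) ^ (n - m) * of_nat (n choose (n - m))))"
    by (simp only: fps_of_nat[symmetric] fps_mult_left_const_nth expand) (simp only: fps_of_nat WI)
  also have "\<dots> = (\<Sum>m\<le>n. fps_const (int ((2 * n) choose n) * ((-1) ^ (n - m) * int (n choose m) * int ((2 * n + m) choose m))) * I ^ Suc (n + m))"
    unfolding sum_distrib_left
  proof (intro sum.cong refl)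
    fix m assume "m \<in> {..n}"
    then have "n choose (n - m) = n choose m"
      using binomial_symmetric[of m n] by simp
    then show "of_nat ((2 * n) choose n) * (of_nat ((2 * n + m) choose m) * I ^ Suc (n + m) * ((-1) ^ (n - m) * of_nat (n choose (n - m))))
      = fps_const (int ((2 * n) choose n) * ((-1) ^ (n - m) * int (n choose m) * int ((2 * n + m) choose m))) * I ^ Suc (n + m)"
      by (simp add: fps_of_nat fps_const_mult[symmetric] fps_const_power[symmetric] fps_const_neg[symmetric] algebra_simps del: fps_const_mult fps_const_power fps_const_neg)
  qed
  also have "\<dots> $ n = (\<Sum>m\<le>n. int ((2 * n) choose n) * ((-1) ^ (n - m) * int (n choose m) * int ((2 * n + m) choose m)) * int ((2 * n + m) choose n))"
    by (simp only: fps_sum_nth fps_mult_left_const_nth Ipow) (simp add: mult_2 add.commute add.left_commute)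
  finally show ?thesis by (simp add: sum_distrib_left mult.assoc)
qed

section \<open>Binomial identities\<close>

text \<open>By Pascal's rule a forward difference in the upper argument lowers the bottom index by
  one; the sum is the \<open>n\<close>-fold difference at \<open>x\<close>.\<close>

lemma choose_forward_difference:
  "(\<Sum>m\<le>n. (-1) ^ (n - m) * int (n choose m) * int ((x + m) choose (r + n))) = int (x choose r)"
proof (induction n arbitrary: x r)
  case 0
  then show ?case by simp
next
  case (Suc n)
  define f where "f m = int ((x + m) choose (r + Suc n))" for m
  \<comment> \<open>At \<open>m = n\<close> the truncated exponent \<open>n - Suc m\<close> breaks
    the sign rule, but there the binomial is \<open>0\<close>.\<close>
  have neg: "(-1) ^ (n - m) * int (n choose Suc m) = - ((-1) ^ (n - Suc m) * int (n choose Suc m))" if "m \<le> n" for m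
    using that by (cases "m = n") (auto simp: Suc_diff_Suc[symmetric] less_le)
  have shift: "(\<Sum>m\<le>n. (-1) ^ (n - m) * int (n choose m) * f m)
      = (-1) ^ n * f 0 + (\<Sum>m\<le>n. (-1) ^ (n - Suc m) * int (n choose Suc m) * f (Suc m))"
    using sum.atMost_Suc_shift[of "\<lambda>m. (-1) ^ (n - m) * int (n choose m) * f m" n] by (simp add: binomial_eq_0)
  have "(\<Sum>m\<le>Suc n. (-1) ^ (Suc n - m) * int (Suc n choose m) * f m)
      = (-1) ^ Suc n * f 0 + (\<Sum>m\<le>n. (-1) ^ (n - m) * int (n choose m) * f (Suc m)
        + (-1) ^ (n - m) * int (n choose Suc m) * f (Suc m))"
    by (subst sum.atMost_Suc_shift) (simp add: algebra_simps)
  also have "\<dots> = (-1) ^ Suc n * f 0 + (\<Sum>m\<le>n. (-1) ^ (n - m) * int (n choose m) * f (Suc m)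
        - (-1) ^ (n - Suc m) * int (n choose Suc m) * f (Suc m))"
    by (intro arg_cong2[where f = "(+)"] refl sum.cong) (simp only: neg atMost_iff, simp)
  also have "\<dots> = (\<Sum>m\<le>n. (-1) ^ (n - m) * int (n choose m) * f (Suc m))
        - (\<Sum>m\<le>n. (-1) ^ (n - m) * int (n choose m) * f m)"
    unfolding shift sum_subtractf by simp
  also have "\<dots> = (\<Sum>m\<le>n. (-1) ^ (n - m) * int (n choose m) * int ((x + m) choose (r + n)))"
    unfolding sum_subtractf[symmetric] by (intro sum.cong refl) (simp add: f_def algebra_simps)
  finally show ?case using Suc.IH by (simp add: f_def)
qed

text \<open>Vandermonde splits \<open>(2 * n + m) choose n\<close> over \<open>k\<close>; after
  regrouping, the sum over \<open>m\<close> is an \<open>n\<close>-th difference with value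
  \<open>(2 * n) choose (n + k)\<close>, and the signs disappear.\<close>

lemma diagonal_sum_positive:
  "(\<Sum>m\<le>n. (-1) ^ (n - m) * int (n choose m) * int ((2 * n + m) choose m) * int ((2 * n + m) choose n))
    = (\<Sum>k\<le>n. int ((2 * n) choose (n - k)) ^ 2 * int ((2 * n + k) choose k))"
proof -
  let ?c = "\<lambda>m. (-1) ^ (n - m) * int (n choose m)"
  \<comment> \<open>For \<open>k \<le> m\<close> both sides are the multinomial
    \<open>(2n + m)! / ((2n)! k! (m - k)!)\<close>.\<close>
  have prod: "((2 * n + m) choose m) * (m choose k) = ((2 * n + k) choose k) * ((2 * n + m) choose (2 * n + k))"
    for m k
  proof (cases "k \<le> m")
    case True
    have "((2 * n + m) choose m) * (m choose k) = ((2 * n + m) choose k) * ((2 * n + m - k) choose (m - k))"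
      using True by (simp add: binomial_absorb_comp choose_mult)
    also have "(2 * n + m - k) choose (m - k) = (2 * n + m - k) choose (2 * n)"
      using True by (subst binomial_symmetric) auto
    also have "((2 * n + m) choose k) * \<dots> = ((2 * n + m) choose (2 * n + k)) * ((2 * n + k) choose k)"
      using True by (subst choose_mult[of k "2 * n + k"]) auto
    finally show ?thesis by simp
  qed (simp add: binomial_eq_0)
  have add_n: "n + k + n = 2 * n + k" for k
    by simp
  have "(\<Sum>m\<le>n. ?c m * int ((2 * n + m) choose m) * int ((2 * n + m) choose n))
      = (\<Sum>m\<le>n. ?c m * int ((2 * n + m) choose m) * (\<Sum>k\<le>n. int (m choose k) * int ((2 * n) choose (n - k))))"
  proof (intro sum.cong refl)
    fix m
    have "(2 * n + m) choose n = (\<Sum>k\<le>n. (m choose k) * ((2 * n) choose (n - k)))"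
      by (simp add: vandermonde add.commute)
    then show "?c m * int ((2 * n + m) choose m) * int ((2 * n + m) choose n)
      = ?c m * int ((2 * n + m) choose m) * (\<Sum>k\<le>n. int (m choose k) * int ((2 * n) choose (n - k)))"
      by simp
  qed
  also have "\<dots> = (\<Sum>k\<le>n. \<Sum>m\<le>n. ?c m * int (((2 * n + m) choose m) * (m choose k)) * int ((2 * n) choose (n - k)))"
    by (subst sum.swap) (simp add: sum_distrib_left mult.assoc)
  also have "\<dots> = (\<Sum>k\<le>n. int ((2 * n) choose (n - k)) * int ((2 * n + k) choose k)
      * (\<Sum>m\<le>n. ?c m * int ((2 * n + m) choose (n + k + n))))"
    unfolding sum_distrib_left by (intro sum.cong refl) (simp only: prod add_n, simp add: ac_simps)
  also have "\<dots> = (\<Sum>k\<le>n. int ((2 * n) choose (n - k)) ^ 2 * int ((2 * n + k) choose k))"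
  proof (intro sum.cong refl)
    fix k assume "k \<in> {..n}"
    then have "(2 * n) choose (n + k) = (2 * n) choose (n - k)"
      by (subst binomial_symmetric) auto
    then show "int ((2 * n) choose (n - k)) * int ((2 * n + k) choose k)
      * (\<Sum>m\<le>n. ?c m * int ((2 * n + m) choose (n + k + n)))
      = int ((2 * n) choose (n - k)) ^ 2 * int ((2 * n + k) choose k)"
      by (simp add: choose_forward_difference power2_eq_square)
  qed
  finally show ?thesis .
qed

section \<open>Evaluation of the alternating sum of fourth powers\<close>

text \<open>Vandermonde expands one of the two factors over \<open>k\<close>; times the other
  factor, each nonzero term is the multinomial \<open>(2n)! / (k!^2 (i - k)! (2n - i - k)!)\<close>.
  The guard is there because a truncated \<open>i - k = 0\<close> would give the binomial
  \<open>1\<close>.\<close>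

lemma square_choose_eq_sum:
  assumes "i \<le> 2 * n"
  shows "((2 * n) choose i) ^ 2
    = (\<Sum>k\<le>n. ((2 * n) choose (2 * k)) * ((2 * k) choose k) * (if k \<le> i then (2 * n - 2 * k) choose (i - k) else 0))"
proof -
  have "(2 * n) choose i = (\<Sum>k\<le>i. ((2 * n - i) choose k) * (i choose (i - k)))"
    using vandermonde[of "2 * n - i" i i] assms by simp
  also have "\<dots> = (\<Sum>k\<le>i. (i choose k) * ((2 * n - i) choose k))"
    by (intro sum.cong refl) (simp add: binomial_symmetric[symmetric])
  also have "\<dots> = (\<Sum>k\<in>{..n} \<inter> {..i}. (i choose k) * ((2 * n - i) choose k))"
    by (rule sum.mono_neutral_right) auto
  also have "\<dots> = (\<Sum>k\<le>n. if k \<le> i then (i choose k) * ((2 * n - i) choose k) else 0)"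
    by (subst sum.inter_restrict) simp_all
  finally have *: "(2 * n) choose i = \<dots>" .
  have "((2 * n) choose i) * (i choose k) * ((2 * n - i) choose k)
      = ((2 * n) choose (2 * k)) * ((2 * k) choose k) * ((2 * n - 2 * k) choose (i - k))" if k: "k \<le> i" "k \<le> n" for k
  proof (cases "i + k \<le> 2 * n")
    case True
    have e: "2 * n - 2 * k - (i - k) = 2 * n - i - k" using k by simp
    have "real (((2 * n) choose i) * (i choose k) * ((2 * n - i) choose k))
      = real (((2 * n) choose (2 * k)) * ((2 * k) choose k) * ((2 * n - 2 * k) choose (i - k)))"
      using True k assms by (simp add: binomial_fact e field_simps)
    then show ?thesis by (simp only: of_nat_eq_iff)
  next
    case False
    then have "2 * n - i < k"
      using k assms by linarith
    then show ?thesis using k by (simp add: binomial_eq_0)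
  qed
  then show ?thesis
    unfolding power2_eq_square by (subst (2) *) (auto simp: sum_distrib_left mult.assoc intro!: sum.cong)
qed

lemma coeff_one_linear_power:
  "poly.coeff ([:1, c:] ^ m) i = c ^ i * of_nat (m choose i)" for c :: "'a::comm_ring_1"
proof (induction m arbitrary: i)
  case 0
  then show ?case by (cases i) auto
next
  case (Suc m)
  then show ?case by (cases i) (simp_all add: coeff_pCons algebra_simps)
qed

text \<open>Since \<open>(1 + y)^2 - (1 - y)^2 = 4 y\<close>, raising \<open>b\<close> is traded for
  raising \<open>a\<close> and a shift in degree, hence induction on \<open>b\<close> for arbitrary
  \<open>a\<close>. The values are signed super Catalan numbers.\<close>

lemma von_szily:
  "real_of_int (poly.coeff ([:1, 1:] ^ (2 * a) * [:1, -1:] ^ (2 * b)) (a + b))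
    = (-1) ^ b * fact (2 * a) * fact (2 * b) / (fact a * fact b * fact (a + b))"
proof (induction b arbitrary: a)
  case 0
  have "poly.coeff ([:1, 1:] ^ (2 * a) :: int poly) a = int ((2 * a) choose a)"
    by (simp add: coeff_one_linear_power)
  then show ?case by (simp add: binomial_fact mult_2)
next
  case (Suc b)
  let ?P = "[:1, 1:] :: int poly" and ?Q = "[:1, -1:] :: int poly"
  have "P ^ (2 * a) * Q ^ (2 * b) * (P ^ 2 - Q ^ 2)
      = P ^ (2 * Suc a) * Q ^ (2 * b) - P ^ (2 * a) * Q ^ (2 * Suc b)" for P Q :: "int poly"
    by (simp add: algebra_simps power2_eq_square)
  moreover have "?P ^ 2 - ?Q ^ 2 = [:0, 4:]"
    by (simp add: power2_eq_square)
  ultimately have "?P ^ (2 * a) * ?Q ^ (2 * b) * [:0, 4:]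
      = ?P ^ (2 * Suc a) * ?Q ^ (2 * b) - ?P ^ (2 * a) * ?Q ^ (2 * Suc b)"
    by metis
  then have "poly.coeff (?P ^ (2 * a) * ?Q ^ (2 * b) * [:0, 4:]) (Suc (a + b))
      = poly.coeff (?P ^ (2 * Suc a) * ?Q ^ (2 * b)) (Suc a + b)
      - poly.coeff (?P ^ (2 * a) * ?Q ^ (2 * Suc b)) (a + Suc b)"
    by simp
  moreover have "poly.coeff (?P ^ (2 * a) * ?Q ^ (2 * b) * [:0, 4:]) (Suc (a + b))
      = 4 * poly.coeff (?P ^ (2 * a) * ?Q ^ (2 * b)) (a + b)"
    by simp
  ultimately have "real_of_int (poly.coeff (?P ^ (2 * a) * ?Q ^ (2 * Suc b)) (a + Suc b))
      = real_of_int (poly.coeff (?P ^ (2 * Suc a) * ?Q ^ (2 * b)) (Suc a + b))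
      - 4 * real_of_int (poly.coeff (?P ^ (2 * a) * ?Q ^ (2 * b)) (a + b))"
    by simp
  also have "\<dots> = (-1) ^ Suc b * fact (2 * a) * fact (2 * Suc b) / (fact a * fact (Suc b) * fact (a + Suc b))"
  proof -
    \<comment> \<open>All three fractions are multiples of \<open>K\<close>; \<open>cancel\<close>
      serves both neighbours, with \<open>a\<close> and \<open>b\<close> exchanged. What remains is
      a linear identity over the denominator \<open>a + b + 1\<close>.\<close>
    define K :: real where "K = (-1) ^ b * fact (2 * a) * fact (2 * b) / (fact a * fact b * fact (a + b))"
    have cancel: "u * (2 * x * y * A) * B / ((x * p) * q * (c * r)) = u * A * B / (p * q * r) * (2 * y / c)"
      if "x \<noteq> 0" for u x y A B p q c r :: real
      using that by (simp add: ac_simps)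
    have double: "fact (2 * Suc m) = 2 * (real m + 1) * (2 * real m + 1) * fact (2 * m)"
      and suc: "fact (Suc m) = (real m + 1) * fact m"
      and sum: "fact (Suc a + b) = (real a + real b + 1) * fact (a + b)" for m
      by (simp_all add: algebra_simps)
    have left: "(-1) ^ b * fact (2 * Suc a) * fact (2 * b) / (fact (Suc a) * fact b * fact (Suc a + b))
        = K * (2 * (2 * real a + 1) / (real a + real b + 1))"
      unfolding K_def double suc sum by (rule cancel) simp
    have "(-1) ^ Suc b * fact (2 * a) * fact (2 * Suc b) / (fact a * fact (Suc b) * fact (a + Suc b))
        = (-1 :: real) ^ Suc b * fact (2 * Suc b) * fact (2 * a) / (fact (Suc b) * fact a * fact (Suc a + b))"
      by (simp only: ac_simps add_Suc add_Suc_right)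
    also have "\<dots> = (-1) ^ Suc b * fact (2 * b) * fact (2 * a) / (fact b * fact a * fact (a + b))
        * (2 * (2 * real b + 1) / (real a + real b + 1))"
      unfolding double[of b] suc[of b] sum by (rule cancel) simp
    also have "\<dots> = - K * (2 * (2 * real b + 1) / (real a + real b + 1))"
      by (simp add: K_def ac_simps)
    finally have right: "(-1) ^ Suc b * fact (2 * a) * fact (2 * Suc b) / (fact a * fact (Suc b) * fact (a + Suc b))
        = - K * (2 * (2 * real b + 1) / (real a + real b + 1))" .
    have "2 * (2 * real a + 1) / (real a + real b + 1) - 4 = - (2 * (2 * real b + 1) / (real a + real b + 1))"
      by (simp add: field_simps)
    then have "K * (2 * (2 * real a + 1) / (real a + real b + 1)) - 4 * K
        = - K * (2 * (2 * real b + 1) / (real a + real b + 1))"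
      by (metis minus_mult_commute mult.commute right_diff_distrib)
    then show ?thesis
      unfolding Suc.IH left right K_def[symmetric] .
  qed
  finally show ?case .
qed

lemma sum_atMost_flip: "(\<Sum>k\<le>n. f (n - k)) = (\<Sum>k\<le>n::nat. f k)"
  by (rule sum.reindex_bij_witness[of _ "\<lambda>k. n - k" "\<lambda>k. n - k"]) auto

text \<open>The coefficient of degree \<open>2 * n\<close> in \<open>V 1 * V (-1)\<close> is
  computed twice: by convolving the coefficients of \<open>V\<close>, and from the expansion
  defining \<open>V\<close> with von Szily's identity.\<close>

lemma alternating_fourth_powers_double_sum:
  "(\<Sum>i\<le>2 * n. (-1) ^ i * real ((2 * n) choose i) ^ 4) = (-1) ^ n * (\<Sum>k\<le>n. \<Sum>l\<le>n.
    fact (2 * n) ^ 2 / (fact (n - k) ^ 2 * fact (n - l) ^ 2 * fact k * fact l * fact (k + l)))"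
proof -
  define \<alpha> where "\<alpha> k = ((2 * n) choose (2 * k)) * ((2 * k) choose k)" for k
  define V :: "int \<Rightarrow> int poly" where
    "V c = (\<Sum>k\<le>n. smult (c ^ k * int (\<alpha> k)) (monom 1 k * [:1, c:] ^ (2 * n - 2 * k)))" for c
  define S where "S a b = (fact (2 * a) * fact (2 * b) / (fact a * fact b * fact (a + b)) :: real)" for a b
  have V: "poly.coeff (V c) i = c ^ i * int ((2 * n) choose i) ^ 2" if "i \<le> 2 * n" for c i
  proof -
    have "poly.coeff (V c) i = (\<Sum>k\<le>n. c ^ i * int (\<alpha> k * (if k \<le> i then (2 * n - 2 * k) choose (i - k) else 0)))"
      unfolding V_def coeff_sum
      by (intro sum.cong refl)
         (auto simp: coeff_monom_mult coeff_one_linear_power power_add[symmetric])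
    also have "\<dots> = c ^ i * int (((2 * n) choose i) ^ 2)"
      by (subst square_choose_eq_sum[OF that]) (simp add: sum_distrib_left \<alpha>_def)
    finally show ?thesis by simp
  qed
  have summand: "real_of_int (poly.coeff (smult (int (\<alpha> k)) (monom 1 k * [:1, 1:] ^ (2 * n - 2 * k))
        * smult ((-1) ^ l * int (\<alpha> l)) (monom 1 l * [:1, -1:] ^ (2 * n - 2 * l))) (2 * n))
      = (-1) ^ n * (real (\<alpha> k) * real (\<alpha> l) * S (n - k) (n - l))" if "k \<le> n" "l \<le> n" for k l
  proof -
    have mon: "monom 1 (k + l) = (monom 1 k * monom 1 l :: int poly)"
      by (simp add: mult_monom)
    have "smult (int (\<alpha> k)) (monom 1 k * [:1, 1:] ^ (2 * n - 2 * k))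
        * smult ((-1) ^ l * int (\<alpha> l)) (monom 1 l * [:1, -1:] ^ (2 * n - 2 * l))
      = smult (int (\<alpha> k) * ((-1) ^ l * int (\<alpha> l)))
          (monom 1 (k + l) * ([:1, 1:] ^ (2 * (n - k)) * [:1, -1:] ^ (2 * (n - l))))"
      by (simp only: mon mult_smult_left mult_smult_right smult_smult diff_mult_distrib diff_mult_distrib2 ac_simps)
    \<comment> \<open>Removing the monomial turns degree \<open>2 * n\<close> into exactly the
      middle degree of the remaining product.\<close>
    moreover have "2 * n - (k + l) = (n - k) + (n - l)"
      using that by simp
    ultimately have "real_of_int (poly.coeff (smult (int (\<alpha> k)) (monom 1 k * [:1, 1:] ^ (2 * n - 2 * k))
        * smult ((-1) ^ l * int (\<alpha> l)) (monom 1 l * [:1, -1:] ^ (2 * n - 2 * l))) (2 * n))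
      = real (\<alpha> k) * ((-1) ^ l * real (\<alpha> l)) * real_of_int (poly.coeff
          ([:1, 1:] ^ (2 * (n - k)) * [:1, -1:] ^ (2 * (n - l))) ((n - k) + (n - l)))"
      using that by (simp add: coeff_monom_mult)
    also have "\<dots> = ((-1) ^ l * (-1) ^ (n - l)) * (real (\<alpha> k) * real (\<alpha> l) * S (n - k) (n - l))"
      unfolding von_szily S_def by (simp add: field_simps)
    \<comment> \<open>The signs from \<open>V (-1)\<close> and from von Szily's identity combine to
      one independent of \<open>k\<close> and \<open>l\<close>.\<close>
    also have "(-1) ^ l * (-1) ^ (n - l) = ((-1) ^ n :: real)"
      using that by (simp flip: power_add)
    finally show ?thesis .
  qed
  have "(\<Sum>i\<le>2 * n. (-1) ^ i * real ((2 * n) choose i) ^ 4)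
      = real_of_int (poly.coeff (V 1 * V (-1)) (2 * n))"
    unfolding coeff_mult of_int_sum
  proof (intro sum.cong refl)
    fix i assume "i \<in> {..2 * n}"
    then have i: "i \<le> 2 * n" by simp
    \<comment> \<open>The second convolution factor has index \<open>2 * n - i\<close>; symmetry and
      the parity of \<open>2 * n\<close> bring it back to \<open>i\<close>.\<close>
    then have "(2 * n) choose (2 * n - i) = (2 * n) choose i" "(-1) ^ (2 * n - i) = ((-1) ^ i :: int)"
      by (auto simp: binomial_symmetric[symmetric] uminus_power_if)
    then show "(-1) ^ i * real ((2 * n) choose i) ^ 4 = real_of_int (poly.coeff (V 1) i * poly.coeff (V (-1)) (2 * n - i))"
      using i by (simp add: V flip: power_add)
  qed
  also have "\<dots> = (\<Sum>k\<le>n. \<Sum>l\<le>n. (-1) ^ n * (real (\<alpha> k) * real (\<alpha> l) * S (n - k) (n - l)))"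
    unfolding V_def power_one mult_1 sum_product coeff_sum of_int_sum
    by (intro sum.cong refl) (rule summand; simp)
  also have "\<dots> = (-1) ^ n * (\<Sum>k\<le>n. \<Sum>l\<le>n. real (\<alpha> k) * real (\<alpha> l) * S (n - k) (n - l))"
    by (simp add: sum_distrib_left)
  also have "(\<Sum>k\<le>n. \<Sum>l\<le>n. real (\<alpha> k) * real (\<alpha> l) * S (n - k) (n - l))
      = (\<Sum>k\<le>n. \<Sum>l\<le>n. fact (2 * n) ^ 2 / (fact k ^ 2 * fact l ^ 2
          * fact (n - k) * fact (n - l) * fact ((n - k) + (n - l))))"
  proof (intro sum.cong refl)
    have \<alpha>: "real (\<alpha> k) = fact (2 * n) / (fact (2 * (n - k)) * fact k ^ 2)" if "k \<le> n" for k
      using that by (simp add: \<alpha>_def binomial_fact diff_mult_distrib2 mult_2 power2_eq_square)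
    fix k l assume "k \<in> {..n}" "l \<in> {..n}"
    then show "real (\<alpha> k) * real (\<alpha> l) * S (n - k) (n - l) = fact (2 * n) ^ 2 / (fact k ^ 2 * fact l ^ 2
          * fact (n - k) * fact (n - l) * fact ((n - k) + (n - l)))"
      by (simp add: \<alpha> S_def power2_eq_square)
  qed
  also have "\<dots> = (\<Sum>k\<le>n. \<Sum>l\<le>n. fact (2 * n) ^ 2 / (fact (n - (n - k)) ^ 2 * fact (n - (n - l)) ^ 2
          * fact (n - k) * fact (n - l) * fact ((n - k) + (n - l))))"
    by (intro sum.cong refl) simp
  also have "\<dots> = (\<Sum>k\<le>n. \<Sum>l\<le>n.
    fact (2 * n) ^ 2 / (fact (n - k) ^ 2 * fact (n - l) ^ 2 * fact k * fact l * fact (k + l)))"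
    by (subst (2) sum_atMost_flip[symmetric]) (subst sum_atMost_flip[symmetric], rule refl)
  finally show ?thesis .
qed

text \<open>Once the factors free of \<open>l\<close> are pulled out, the inner sum has terms
  \<open>(n choose l) * ((n + k) choose (n - l))\<close>, which Vandermonde adds up to
  \<open>(2 * n + k) choose n\<close>.\<close>

lemma alternating_fourth_powers:
  "(\<Sum>i\<le>2 * n. (-1) ^ i * int ((2 * n) choose i) ^ 4) = (-1) ^ n * int ((2 * n) choose n) *
    (\<Sum>k\<le>n. int ((2 * n) choose (n - k)) ^ 2 * int ((2 * n + k) choose k))"
proof -
  have inner: "(\<Sum>l\<le>n. fact (2 * n) ^ 2 / (fact (n - k) ^ 2 * fact (n - l) ^ 2 * fact k * fact l * fact (k + l)))
      = real ((2 * n) choose n) * (real ((2 * n) choose (n - k)) ^ 2 * real ((2 * n + k) choose k))"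
    if k: "k \<le> n" for k
  proof -
    have "(\<Sum>l\<le>n. fact (2 * n) ^ 2 / (fact (n - k) ^ 2 * fact (n - l) ^ 2 * fact k * fact l * fact (k + l)))
      = (\<Sum>l\<le>n. fact (2 * n) ^ 2 / (fact (n - k) ^ 2 * fact k * fact n * fact (n + k))
          * (real (n choose l) * real ((n + k) choose (n - l))))"
    proof (intro sum.cong refl)
      fix l assume "l \<in> {..n}"
      then have "n + k - (n - l) = k + l" "l \<le> n" by auto
      then show "fact (2 * n) ^ 2 / (fact (n - k) ^ 2 * fact (n - l) ^ 2 * fact k * fact l * fact (k + l))
        = fact (2 * n) ^ 2 / (fact (n - k) ^ 2 * fact k * fact n * fact (n + k))
          * (real (n choose l) * real ((n + k) choose (n - l)))"
        by (simp add: binomial_fact power2_eq_square)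
    qed
    also have "\<dots> = fact (2 * n) ^ 2 / (fact (n - k) ^ 2 * fact k * fact n * fact (n + k))
        * real (\<Sum>l\<le>n. (n choose l) * ((n + k) choose (n - l)))"
      by (simp add: sum_distrib_left)
    also have "\<dots> = fact (2 * n) ^ 2 / (fact (n - k) ^ 2 * fact k * fact n * fact (n + k))
        * real ((2 * n + k) choose n)"
      by (simp only: vandermonde) (simp add: mult_2 add.assoc)
    also have "\<dots> = real ((2 * n) choose n) * (real ((2 * n) choose (n - k)) ^ 2 * real ((2 * n + k) choose k))"
    proof -
      have "2 * n + k - n = n + k" "2 * n - (n - k) = n + k" "2 * n - n = n"
        using k by auto
      then show ?thesis
        using k by (simp add: binomial_fact power2_eq_square ac_simps)
    qed
    finally show ?thesis .
  qed
  have "(\<Sum>i\<le>2 * n. (-1) ^ i * real ((2 * n) choose i) ^ 4) = (-1) ^ n *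
      (\<Sum>k\<le>n. real ((2 * n) choose n) * (real ((2 * n) choose (n - k)) ^ 2 * real ((2 * n + k) choose k)))"
    unfolding alternating_fourth_powers_double_sum
    by (intro arg_cong2[where f = "(*)"] refl sum.cong) (simp add: inner)
  then have "real_of_int (\<Sum>i\<le>2 * n. (-1) ^ i * int ((2 * n) choose i) ^ 4)
      = real_of_int ((-1) ^ n * int ((2 * n) choose n) *
        (\<Sum>k\<le>n. int ((2 * n) choose (n - k)) ^ 2 * int ((2 * n + k) choose k)))"
    by (simp add: sum_distrib_left mult.assoc)
  then show ?thesis by (simp only: of_int_eq_iff)
qed

section \<open>Counting labelings\<close>

text \<open>\<open>0 \<in> A\<close> gives the reflected set the same maximum, so the reflection
  formed with that set's own maximum undoes the first one.\<close>

lemma image_diff_Max: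
  fixes A :: "nat set"
  assumes "finite A" "0 \<in> A"
  shows "Max ((\<lambda>x. Max A - x) ` A) = Max A" "inj_on (\<lambda>x. Max A - x) A"
    "(\<lambda>x. Max A - x) ` (\<lambda>x. Max A - x) ` A = A" "0 \<in> (\<lambda>x. Max A - x) ` A"
proof -
  have le: "x \<le> Max A" if "x \<in> A" for x
    using assms(1) that by (rule Max_ge)
  have "Max A \<in> (\<lambda>x. Max A - x) ` A"
    using assms(2) by (intro image_eqI[of _ _ 0]) auto
  then show "Max ((\<lambda>x. Max A - x) ` A) = Max A"
    using assms(1) by (intro Max_eqI) auto
  show "inj_on (\<lambda>x. Max A - x) A"
    by (intro inj_onI) (metis diff_diff_cancel le)
  show "(\<lambda>x. Max A - x) ` (\<lambda>x. Max A - x) ` A = A"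
    unfolding image_image using le by simp
  have "Max A \<in> A" using assms by (intro Max_in) auto
  then show "0 \<in> (\<lambda>x. Max A - x) ` A" by (intro image_eqI[of _ _ "Max A"]) auto
qed

text \<open>The pair \<open>(S', S'')\<close> corresponds to the tiling by \<open>max S' - S'\<close> and \<open>S'' - max S' - 1\<close>.\<close>

lemma card_label_set_pairs:
  assumes "a > 0" "b > 0"
  shows "card (label_set_pairs a b) = card (tilings a b)"
proof -
  define f :: "nat set \<times> nat set \<Rightarrow> nat set \<times> nat set" where "f = (\<lambda>(S, T). ((\<lambda>x. Max S - x) ` S, (\<lambda>y. y - Max S - 1) ` T))"
  define g :: "nat set \<times> nat set \<Rightarrow> nat set \<times> nat set" where "g = (\<lambda>(A, B). ((\<lambda>x. Max A - x) ` A, (\<lambda>y. y + Max A + 1) ` B))"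
  have f: "f (S, T) \<in> tilings a b \<and> g (f (S, T)) = (S, T)" if ST: "(S, T) \<in> label_set_pairs a b" for S T
  proof -
    let ?A = "(\<lambda>x. Max S - x) ` S" and ?B = "(\<lambda>y. y - Max S - 1) ` T"
    have sub: "S \<subseteq> {0..a * b}" "T \<subseteq> {0..a * b}" and card: "card S = a" "card T = b"
      and D: "{int y - int x | x y. x \<in> S \<and> y \<in> T} = {1..int (a * b)}"
      using ST by (auto simp: label_set_pairs_def)
    have fin: "finite S" "finite T" using sub by (auto intro: finite_subset)
    \<comment> \<open>The difference \<open>a * b\<close> between labels in
      \<open>{0..a * b}\<close> forces the label \<open>0\<close> into \<open>S\<close>.\<close>
    have "int (a * b) \<in> {int y - int x | x y. x \<in> S \<and> y \<in> T}"
      unfolding D using assms by (simp add: Suc_le_eq flip: of_nat_mult)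
    then obtain x y where "x \<in> S" "y \<in> T" "int (a * b) = int y - int x" by blast
    moreover have "y \<le> a * b" using \<open>y \<in> T\<close> sub by auto
    ultimately have "x = 0" by linarith
    then have "0 \<in> S" using \<open>x \<in> S\<close> by simp
    note S = image_diff_Max[OF fin(1) this]
    have "Max S \<in> S" using fin \<open>0 \<in> S\<close> by (intro Max_in) auto
    \<comment> \<open>Positive differences place \<open>T\<close> above \<open>Max S\<close>, so the
      truncated subtractions in \<open>?B\<close> are exact.\<close>
    have T: "Max S < y" if "y \<in> T" for y
    proof -
      have "int y - int (Max S) \<in> {1..int (a * b)}"
        unfolding D[symmetric] using that \<open>Max S \<in> S\<close> by blast
      then show ?thesis by simp
    qed
    have injT: "inj_on (\<lambda>y. y - Max S - 1) T"
      by (intro inj_onI) (use T in \<open>metis Suc_diff_Suc Suc_eq_plus1 add_diff_cancel_right' diff_diff_left eq_diff_iff less_imp_le\<close>)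
    have cards: "card ?A = a" "card ?B = b"
      using S(2) injT card by (simp_all add: card_image)
    \<comment> \<open>Differences start at \<open>1\<close> but tiled intervals at \<open>0\<close>;
      the \<open>- 1\<close> aligns them.\<close>
    have sum: "int ((Max S - x) + (y - Max S - 1)) = int y - int x - 1" if "x \<in> S" "y \<in> T" for x y
      using T[OF that(2)] Max_ge[OF fin(1) that(1)] by simp
    have image: "(\<lambda>(x, y). x + y) ` (?A \<times> ?B) = {..<a * b}"
    proof (intro equalityI subsetI)
      fix z assume "z \<in> (\<lambda>(x, y). x + y) ` (?A \<times> ?B)"
      then obtain x y where xy: "x \<in> S" "y \<in> T" "z = (Max S - x) + (y - Max S - 1)" by auto
      have "int y - int x \<in> {1..int (a * b)}"
        unfolding D[symmetric] using xy by blast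
      moreover have "int z = int y - int x - 1"
        unfolding xy(3) by (rule sum[OF xy(1,2)])
      ultimately have "int z < int (a * b)" by (simp only: atLeastAtMost_iff) linarith
      then show "z \<in> {..<a * b}" by (simp only: of_nat_less_iff lessThan_iff)
    next
      fix z assume "z \<in> {..<a * b}"
      then have "int z + 1 \<in> {int y - int x | x y. x \<in> S \<and> y \<in> T}"
        unfolding D by (simp flip: of_nat_mult)
      then obtain x y where xy: "x \<in> S" "y \<in> T" "int z + 1 = int y - int x" by blast
      then have "z = (Max S - x) + (y - Max S - 1)" using sum[OF xy(1,2)] by linarith
      then show "z \<in> (\<lambda>(x, y). x + y) ` (?A \<times> ?B)" using xy by force
    qed
    \<comment> \<open>Injectivity by counting: the image has \<open>a * b\<close> elements, as many
      as the product.\<close>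
    have "inj_on (\<lambda>(x, y). x + y) (?A \<times> ?B)"
      by (rule eq_card_imp_inj_on) (use fin in \<open>simp_all only: image cards card_cartesian_product card_lessThan finite_cartesian_product finite_imageI\<close>)
    then have "tiles ?A ?B (a * b)"
      using image by (simp add: tiles_def bij_betw_def)
    moreover have "(\<lambda>y. y - Max S - 1 + Max S + 1) ` T = (\<lambda>y. y) ` T"
    proof (intro image_cong refl)
      fix y assume "y \<in> T"
      then show "y - Max S - 1 + Max S + 1 = y" using T[of y] by linarith
    qed
    then have "(\<lambda>y. y + Max S + 1) ` ?B = T"
      by (simp only: image_image image_ident)
    ultimately show ?thesis
      using cards S by (simp add: f_def g_def tilings_def)
  qed
  have g: "g (A, B) \<in> label_set_pairs a b \<and> f (g (A, B)) = (A, B)" if AB: "(A, B) \<in> tilings a b" for A B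
  proof -
    let ?S = "(\<lambda>x. Max A - x) ` A" and ?T = "(\<lambda>y. y + Max A + 1) ` B"
    have card: "card A = a" "card B = b" and t: "tiles A B (a * b)"
      using AB by (auto simp: tilings_def)
    have "a * b > 0" using assms by simp
    note zero = tiles_zero[OF t this]
    have fin: "finite A" "finite B" using card assms by (metis card.infinite less_irrefl)+
    note A = image_diff_Max[OF fin(1) zero(1)]
    have le: "x \<le> Max A" if "x \<in> A" for x using fin(1) that by (rule Max_ge)
    have "Max A \<in> A" using fin zero by (intro Max_in) auto
    \<comment> \<open>Strictness leaves room for the shift by \<open>1\<close> in \<open>g\<close>,
      so labels stay at most \<open>a * b\<close>.\<close>
    then have less: "Max A + y < a * b" if "y \<in> B" for y
      using tiles_less[OF t] that by blast
    have "{int y - int x | x y. x \<in> ?S \<and> y \<in> ?T} = {1..int (a * b)}" (is "?D = _")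
    proof (intro equalityI subsetI)
      fix d assume "d \<in> ?D"
      then obtain x y where xy: "x \<in> A" "y \<in> B" "d = int (y + Max A + 1) - int (Max A - x)" by auto
      then have "d = int (x + y) + 1" using le[OF xy(1)] by simp
      moreover have "int (x + y) < int (a * b)"
        using tiles_less[OF t xy(1,2)] by (simp only: of_nat_less_iff)
      ultimately show "d \<in> {1..int (a * b)}" by (simp only: atLeastAtMost_iff) linarith
    next
      fix d assume d: "d \<in> {1..int (a * b)}"
      then have "nat (d - 1) < a * b" by (simp add: nat_less_iff flip: of_nat_mult)
      then obtain x y where xy: "x \<in> A" "y \<in> B" "nat (d - 1) = x + y" using tilesE[OF t] by blast
      then have "d = int (y + Max A + 1) - int (Max A - x)" using le[OF xy(1)] d by auto
      then show "d \<in> ?D" using xy by blast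
    qed
    moreover have "card ?S = a" "card ?T = b"
      using A(2) card by (auto simp: card_image inj_on_def)
    moreover have "Max A \<le> a * b" using less[OF zero(2)] by simp
    then have "?S \<subseteq> {0..a * b}" "?T \<subseteq> {0..a * b}"
      using less by (auto simp: Suc_le_eq add.commute)
    moreover have "(\<lambda>y. y - Max A - 1) ` ?T = B"
      unfolding image_image by simp
    ultimately show ?thesis
      using A by (simp add: f_def g_def label_set_pairs_def)
  qed
  have "bij_betw f (label_set_pairs a b) (tilings a b)"
    by (rule bij_betw_byWitness[where f' = g]) (use f g in auto)
  then show ?thesis by (rule bij_betw_same_card)
qed

theorem theorem1:
  fixes n p1 p2 q1 q2 a b :: nat
  assumes "n > 0"
    and "prime p1" and "prime p2" and "p1 \<noteq> p2"
    and "prime q1" and "prime q2" and "q1 \<noteq> q2"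
    and "a = p1 ^ n * p2 ^ n" and "b = q1 ^ n * q2 ^ n"
  shows "int (num_alpha a b) = (\<Sum>i=0..2*n. (-1) ^ (n + i) * int ((2 * n) choose i) ^ 4) \<and>
    (\<Sum>i=0..2*n. (-1) ^ (n + i) * int ((2 * n) choose i) ^ 4)
      = (-1) ^ n * (\<Sum>i=0..2*n. (-1) ^ i * int ((2 * n) choose i) ^ 4)"
proof
  show sign: "(\<Sum>i=0..2*n. (-1) ^ (n + i) * int ((2 * n) choose i) ^ 4)
      = (-1) ^ n * (\<Sum>i=0..2*n. (-1) ^ i * int ((2 * n) choose i) ^ 4)"
    by (simp add: power_add sum_distrib_left mult.assoc)
  have pos: "p1 ^ i * p2 ^ j > 0" "q1 ^ i * q2 ^ j > 0" for i j
    using assms by (auto simp: prime_gt_0_nat)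
  \<comment> \<open>Four separate exponents keep the two sides apart even if \<open>a\<close> and
    \<open>b\<close> share a prime: each term of the recurrence contracts one side only.\<close>
  define N where "N i j k l = int (card (tilings (p1 ^ i * p2 ^ j) (q1 ^ k * q2 ^ l)))" for i j k l
  have swap: "card (tilings c d) = card (tilings d c)" for c d
    by (rule bij_betw_same_card[of prod.swap], rule bij_betw_byWitness[where f' = prod.swap])
       (auto simp: tilings_swap)
  have "N i j k l = (if i = 0 \<and> j = 0 \<and> k = 0 \<and> l = 0 then 1 else 0)
      + (if i = 0 then 0 else N (i - 1) j k l) + (if j = 0 then 0 else N i (j - 1) k l)
      - (if i = 0 \<or> j = 0 then 0 else N (i - 1) (j - 1) k l)
      + (if k = 0 then 0 else N i j (k - 1) l) + (if l = 0 then 0 else N i j k (l - 1))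
      - (if k = 0 \<or> l = 0 then 0 else N i j (k - 1) (l - 1))" for i j k l
  \<comment> \<open>Splitting by the factor that contains \<open>1\<close> requires a product other
    than \<open>1\<close>; the only tiling of size \<open>1\<close> supplies the initial
    value.\<close>
  proof (cases "i = 0 \<and> j = 0 \<and> k = 0 \<and> l = 0")
    case True
    then show ?thesis using card_tilings_one by (simp add: N_def)
  next
    case False
    then have "p1 ^ i * p2 ^ j * (q1 ^ k * q2 ^ l) \<noteq> 1"
      using assms by (auto simp: prime_gt_Suc_0_nat[THEN less_imp_neq, symmetric])
    then have "card (tilings (p1 ^ i * p2 ^ j) (q1 ^ k * q2 ^ l))
        = card (left_tilings (p1 ^ i * p2 ^ j) (q1 ^ k * q2 ^ l))
        + card (left_tilings (q1 ^ k * q2 ^ l) (p1 ^ i * p2 ^ j))"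
      by (intro card_tilings_split pos)
    then show ?thesis
      unfolding N_def of_nat_add using False
      by (simp only: of_nat_add card_left_tilings[OF assms(2-4) pos(2)] card_left_tilings[OF assms(5-7) pos(1)]
          swap[of "q1 ^ _ * q2 ^ _"] if_False)
  qed
  then have "N n n n n = int ((2 * n) choose n) *
      (\<Sum>k\<le>n. int ((2 * n) choose (n - k)) ^ 2 * int ((2 * n + k) choose k))"
    unfolding diagonal_sum_positive[symmetric] by (rule diagonal_coefficient)
  also have "\<dots> = (-1) ^ n * (\<Sum>i\<le>2 * n. (-1) ^ i * int ((2 * n) choose i) ^ 4)"
    unfolding alternating_fourth_powers by (simp flip: mult.assoc power_add)
  finally have "N n n n n = (-1) ^ n * (\<Sum>i\<le>2 * n. (-1) ^ i * int ((2 * n) choose i) ^ 4)" .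
  moreover have "int (num_alpha a b) = N n n n n"
    using pos by (simp add: assms(8,9) num_alpha_eq_card_label_set_pairs card_label_set_pairs N_def)
  ultimately show "int (num_alpha a b) = (\<Sum>i=0..2*n. (-1) ^ (n + i) * int ((2 * n) choose i) ^ 4)"
    unfolding sign by (simp only: atMost_atLeast0)
qed

end
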